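(* Let $n,k,a,b$ be admissible integers, i.e. integers with $n \geq k \geq 0$, $a > b > 0$, $\gcd(a,b)=1$, and either $n-k<a-b$ or $k<b$. Let $q \in \mathbb{C}\setminus\{0\}$ and define \[ h_q(x) \coloneqq \sum_{j\geq 0} \genfrac{[}{]}{0pt}{}{n+aj}{k+bj}_q x^j \in \mathbb{C}[[x]]. \] Then $h_q(x)$ is an algebraic power series if and only if $q$ is a root of unity.
   Context: For integers $0\le k\le N$ and a variable (or complex number) $q$, the $q$-binomial coefficient is $\genfrac{[}{]}{0pt}{}{N}{k}_q \coloneqq \frac{[N]_q!}{[k]_q!\,[N-k]_q!}$, where $[m]_q! \coloneqq \prod_{i=1}^{m}(1+q+\cdots+q^{i-1})$; it is a polynomial in $q$ with integer coefficients, and $\genfrac{[}{]}{0pt}{}{N}{k}_q$ at a complex number $q$ means the evaluation of this polynomial. A power series $f(x)\in\mathbb{C}[[x]]$ is algebraic if there is a nonzero polynomial $P(x,z)\in\mathbb{C}[x,z]$ with $P(x,f(x))=0$. *)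

theory Defs
  imports Complex_Main "HOL-Computational_Algebra.Computational_Algebra"
begin

definition q_fact :: "nat \<Rightarrow> int poly" where
  "q_fact m = (\<Prod>i=1..m. \<Sum>j<i. monom 1 j)"

text \<open>
  The quotient is exact for \<open>k \<le> N\<close>, see \<open>q_binomial_mult_q_fact\<close> below.
\<close>

definition q_binomial :: "nat \<Rightarrow> nat \<Rightarrow> int poly" where
  "q_binomial N k = q_fact N div (q_fact k * q_fact (N - k))"

text \<open>
  Evaluating the polynomial (rather than the quotient of evaluated factorials) is essential at
  roots of unity, where the denominator may vanish.
\<close>

definition q_binomial_at :: "complex \<Rightarrow> nat \<Rightarrow> nat \<Rightarrow> complex" where
  "q_binomial_at q N k = poly (map_poly of_int (q_binomial N k)) q"

text \<open>
  A bivariate polynomial \<open>P(x, z)\<close> is a polynomial in \<open>z\<close> whose coefficients are polynomials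
  in \<open>x\<close>.
\<close>

definition algebraic_fps :: "complex fps \<Rightarrow> bool" where
  "algebraic_fps f \<longleftrightarrow>
     (\<exists>P :: complex poly poly. P \<noteq> 0 \<and> poly (map_poly fps_of_poly P) f = 0)"

lemma q_fact_Suc: "q_fact (Suc m) = (\<Sum>j<Suc m. monom 1 j) * q_fact m"
  by (simp add: q_fact_def mult.commute)

lemma q_fact_nonzero: "q_fact m \<noteq> 0"
proof -
  have "(\<Sum>j<i. monom (1::int) j) \<noteq> 0" if "i \<ge> 1" for i :: nat
  proof
    assume "(\<Sum>j<i. monom (1::int) j) = 0"
    hence "coeff (\<Sum>j<i. monom (1::int) j) 0 = 0" by simp
    thus False using that by (simp add: coeff_sum)
  qed
  thus ?thesis by (auto simp: q_fact_def)
qed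

lemma q_number_add:
  "(\<Sum>j<m + k. monom (1::int) j) = (\<Sum>j<m. monom 1 j) + monom 1 m * (\<Sum>j<k. monom 1 j)"
  by (induction k) (simp_all add: algebra_simps mult_monom)

lemma q_fact_mult_dvd: "q_fact m * q_fact k dvd q_fact (m + k)"
proof (induction "m + k" arbitrary: m k)
  case 0
  thus ?case by (simp add: q_fact_def)
next
  case (Suc s)
  show ?case
  proof (cases "m = 0 \<or> k = 0")
    case True
    thus ?thesis by (auto simp: q_fact_def)
  next
    case False
    then obtain m' k' where mk: "m = Suc m'" "k = Suc k'"
      by (metis not0_implies_Suc)
    have 1: "q_fact m' * q_fact k dvd q_fact s" and 2: "q_fact m * q_fact k' dvd q_fact s"
      using Suc.hyps(1)[of m' k] Suc.hyps(1)[of m k'] Suc.hyps(2) mk by simp_all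
    have "q_fact m * q_fact k dvd (\<Sum>j<m. monom 1 j) * q_fact s"
      using mult_dvd_mono[OF dvd_refl 1, of "\<Sum>j<m. monom 1 j"]
      by (simp only: mk q_fact_Suc mult.assoc)
    moreover have "q_fact m * q_fact k dvd monom 1 m * ((\<Sum>j<k. monom 1 j) * q_fact s)"
      using dvd_mult[OF mult_dvd_mono[OF dvd_refl 2, of "\<Sum>j<k. monom 1 j"], of "monom 1 m"]
      by (simp only: mk(2) q_fact_Suc mult.left_commute)
    ultimately have "q_fact m * q_fact k dvd
        (\<Sum>j<m. monom 1 j) * q_fact s + monom 1 m * ((\<Sum>j<k. monom 1 j) * q_fact s)"
      by (rule dvd_add)
    also have "\<dots> = q_fact (m + k)"
      unfolding Suc.hyps(2)[symmetric] q_fact_Suc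
      unfolding Suc.hyps(2) q_number_add by (simp only: algebra_simps)
    finally show ?thesis .
  qed
qed

lemma q_binomial_mult_q_fact:
  assumes "k \<le> N"
  shows "q_binomial N k * (q_fact k * q_fact (N - k)) = q_fact N"
  using q_fact_mult_dvd[of k "N - k"] assms by (simp add: q_binomial_def)

end

theory Submission
  imports Defs
begin

text \<open>
  Let \<open>q\<close> be a primitive \<open>m\<close>-th root of unity. By the \<open>q\<close>-Lucas congruence each section of the
  series along a residue class modulo \<open>m\<close> is a constant multiple of some
  \<open>\<Sum>i. (n' + a i choose k' + b i) x^i\<close>. That series is a section of
  \<open>\<Sum>j. (n' - s k' + s j choose j) x^j\<close> with \<open>s = a / b\<close>, which by Lagrange inversion is a rational
  function of \<open>x\<close> and the algebraic series \<open>w\<close> with \<open>w^b = 1 + x w^a\<close>.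

  If \<open>q\<close> is not a root of unity, an algebraic series would satisfy a linear differential equation, so
  its coefficients \<open>u\<close> would satisfy \<open>\<Sum>s. P\<^sub>s(M) u(M + s) = 0\<close> with polynomials \<open>P\<^sub>s\<close>. Since
  \<open>u(M + 1) / u(M)\<close> is a rational function of \<open>Y = q^M\<close> and \<open>M, q^M\<close> are algebraically independent, this
  is an identity of rational functions in independent variables. The ratio has degree
  \<open>a^2 - b^2 - (a - b)^2 > 0\<close> in \<open>Y\<close>, so the summands have distinct degrees in \<open>Y\<close>, a contradiction.
\<close>

section \<open>Algebraic power series\<close>

text \<open>The power series in the span of \<open>B\<close> over the field of rational functions, with denominators
  cleared.\<close>

definition rspan :: "'a::field fps set \<Rightarrow> 'a fps set" where
  "rspan B = {y. \<exists>s c. s \<noteq> 0 \<and> fps_of_poly s * y = (\<Sum>b\<in>B. fps_of_poly (c b) * b)}"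

lemma rspanI:
  "s \<noteq> 0 \<Longrightarrow> fps_of_poly s * y = (\<Sum>b\<in>B. fps_of_poly (c b) * b) \<Longrightarrow> y \<in> rspan B"
  by (auto simp: rspan_def)

lemma rspanE:
  assumes "y \<in> rspan B"
  obtains s c where "s \<noteq> 0" "fps_of_poly s * y = (\<Sum>b\<in>B. fps_of_poly (c b) * b)"
  using assms by (auto simp: rspan_def)

lemma fps_of_poly_eq_0_iff [simp]: "fps_of_poly p = 0 \<longleftrightarrow> p = 0"
  using fps_of_poly_eq_iff[of p 0] by simp

lemma rspan_zero: "0 \<in> rspan B"
  by (rule rspanI[of 1 _ "\<lambda>_. 0"]) auto

lemma rspan_base:
  assumes "finite B" "b \<in> B"
  shows "b \<in> rspan B"
proof (rule rspanI[of 1 _ "\<lambda>x. if x = b then 1 else 0"])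
  have "(\<Sum>x\<in>B. fps_of_poly (if x = b then 1 else 0) * x) = (\<Sum>x\<in>B. if x = b then x else 0)"
    by (rule sum.cong) auto
  thus "fps_of_poly 1 * b = (\<Sum>x\<in>B. fps_of_poly (if x = b then 1 else 0) * x)"
    using assms by simp
qed auto

lemma rspan_add:
  assumes "x \<in> rspan B" "y \<in> rspan B"
  shows "x + y \<in> rspan B"
proof -
  obtain s c where s: "s \<noteq> 0" "fps_of_poly s * x = (\<Sum>b\<in>B. fps_of_poly (c b) * b)"
    using assms(1) by (rule rspanE)
  obtain t d where t: "t \<noteq> 0" "fps_of_poly t * y = (\<Sum>b\<in>B. fps_of_poly (d b) * b)"
    using assms(2) by (rule rspanE)
  show ?thesis
  proof (rule rspanI[of "s * t" _ "\<lambda>b. t * c b + s * d b"])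
    have "fps_of_poly (s * t) * (x + y) =
        fps_of_poly t * (fps_of_poly s * x) + fps_of_poly s * (fps_of_poly t * y)"
      by (simp add: fps_of_poly_mult algebra_simps)
    also have "\<dots> = (\<Sum>b\<in>B. fps_of_poly (t * c b + s * d b) * b)"
      unfolding s(2) t(2)
      by (simp add: sum_distrib_left sum.distrib fps_of_poly_mult fps_of_poly_add algebra_simps)
    finally show "fps_of_poly (s * t) * (x + y) = (\<Sum>b\<in>B. fps_of_poly (t * c b + s * d b) * b)" .
  qed (use s t in auto)
qed

lemma rspan_scale:
  assumes "y \<in> rspan B"
  shows "fps_of_poly p * y \<in> rspan B"
proof -
  obtain s c where s: "s \<noteq> 0" "fps_of_poly s * y = (\<Sum>b\<in>B. fps_of_poly (c b) * b)"
    using assms by (rule rspanE)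
  have "fps_of_poly s * (fps_of_poly p * y) = fps_of_poly p * (fps_of_poly s * y)"
    by (simp add: algebra_simps)
  also have "\<dots> = (\<Sum>b\<in>B. fps_of_poly (p * c b) * b)"
    unfolding s(2) by (simp add: sum_distrib_left fps_of_poly_mult algebra_simps)
  finally show ?thesis using s(1) by (rule rspanI[rotated])
qed

lemma rspan_unscale:
  assumes "fps_of_poly p * y \<in> rspan B" "p \<noteq> 0"
  shows "y \<in> rspan B"
proof -
  obtain s c where s: "s \<noteq> 0" "fps_of_poly s * (fps_of_poly p * y) = (\<Sum>b\<in>B. fps_of_poly (c b) * b)"
    using assms(1) by (rule rspanE)
  show ?thesis
    by (rule rspanI[of "s * p" _ c]) (use s assms(2) in \<open>auto simp: fps_of_poly_mult mult.assoc\<close>)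
qed

lemma rspan_uminus: "y \<in> rspan B \<Longrightarrow> - y \<in> rspan B"
  using rspan_scale[of y B "- 1"] by (simp add: fps_of_poly_uminus)

lemma rspan_diff: "x \<in> rspan B \<Longrightarrow> y \<in> rspan B \<Longrightarrow> x - y \<in> rspan B"
  using rspan_add[of x B "- y"] rspan_uminus[of y B] by simp

lemma rspan_sum: "(\<And>i. i \<in> I \<Longrightarrow> f i \<in> rspan B) \<Longrightarrow> sum f I \<in> rspan B"
  by (induction I rule: infinite_finite_induct) (auto simp: rspan_zero rspan_add)

text \<open>By bilinearity, closure under products need only be checked on generators. Three
  separate sets are allowed so that the lemma serves both a single algebra and the join of
  two.\<close>

lemma rspan_mult_closed:
  assumes "\<And>b c. b \<in> B \<Longrightarrow> c \<in> C \<Longrightarrow> b * c \<in> rspan D"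
    and "u \<in> rspan B" "v \<in> rspan C"
  shows "u * v \<in> rspan D"
proof -
  obtain s c where s: "s \<noteq> 0" "fps_of_poly s * u = (\<Sum>b\<in>B. fps_of_poly (c b) * b)"
    using assms(2) by (rule rspanE)
  obtain t d where t: "t \<noteq> 0" "fps_of_poly t * v = (\<Sum>b\<in>C. fps_of_poly (d b) * b)"
    using assms(3) by (rule rspanE)
  have "fps_of_poly (s * t) * (u * v) = (fps_of_poly s * u) * (fps_of_poly t * v)"
    by (simp add: fps_of_poly_mult algebra_simps)
  also have "\<dots> = (\<Sum>x\<in>B. \<Sum>y\<in>C. fps_of_poly (c x * d y) * (x * y))"
    unfolding s(2) t(2) sum_product by (simp add: fps_of_poly_mult algebra_simps)
  also have "\<dots> \<in> rspan D"
    by (intro rspan_sum rspan_scale assms(1))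
  finally show ?thesis using s(1) t(1) by (simp add: rspan_unscale[of "s * t"])
qed

text \<open>Gaussian elimination, by induction on the generators: either no \<open>y i\<close>
  involves the generator \<open>b\<close>, or one that does serves as a pivot and removes
  \<open>b\<close> from all the others, which still outnumber the remaining generators.\<close>

lemma rspan_dependent:
  assumes "finite B" "finite I" "card B < card I" "\<And>i. i \<in> I \<Longrightarrow> y i \<in> rspan B"
  shows "\<exists>c. (\<exists>i\<in>I. c i \<noteq> 0) \<and> (\<Sum>i\<in>I. fps_of_poly (c i) * y i) = 0"
  using assms
proof (induction B arbitrary: I y rule: finite_induct)
  case empty
  have "y i = 0" if "i \<in> I" for i
    using empty(3)[OF that] by (auto simp: rspan_def)
  moreover have "I \<noteq> {}" using empty by auto
  ultimately show ?case by (intro exI[of _ "\<lambda>_. 1"]) auto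
next
  case (insert b B)
  have "\<exists>s c z. s \<noteq> 0 \<and> z \<in> rspan B \<and> fps_of_poly s * y i = fps_of_poly c * b + z"
    if i: "i \<in> I" for i
  proof -
    obtain s c where s: "s \<noteq> 0" "fps_of_poly s * y i = (\<Sum>x\<in>insert b B. fps_of_poly (c x) * x)"
      using insert.prems(3)[OF i] by (rule rspanE)
    have "(\<Sum>x\<in>B. fps_of_poly (c x) * x) \<in> rspan B"
      using insert.hyps(1) by (intro rspan_sum rspan_scale rspan_base)
    thus ?thesis using s insert.hyps by (auto simp: sum.insert)
  qed
  then obtain s c z where sc: "\<And>i. i \<in> I \<Longrightarrow> s i \<noteq> 0" "\<And>i. i \<in> I \<Longrightarrow> z i \<in> rspan B"
      "\<And>i. i \<in> I \<Longrightarrow> fps_of_poly (s i) * y i = fps_of_poly (c i) * b + z i"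
    by metis
  show ?case
  proof (cases "\<forall>i\<in>I. c i = 0")
    case True
    have "y i \<in> rspan B" if "i \<in> I" for i
      using sc[OF that] True that by (auto intro: rspan_unscale[of "s i"])
    moreover have "card B < card I" using insert by auto
    ultimately show ?thesis using insert.IH[of I y] insert.prems by blast
  next
    case False
    then obtain k where k: "k \<in> I" "c k \<noteq> 0" by auto
    \<comment> \<open>Cross-multiplying with the pivot \<open>y k\<close> cancels the multiples of
      \<open>b\<close>, so \<open>w i\<close> lies in the span of the smaller set.\<close>
    define w where "w = (\<lambda>i. fps_of_poly (c k * s i) * y i - fps_of_poly (c i * s k) * y k)"
    have "w i = fps_of_poly (c k) * z i - fps_of_poly (c i) * z k" if "i \<in> I" for i
    proof -
      have "w i = fps_of_poly (c k) * (fps_of_poly (s i) * y i) - fps_of_poly (c i) * (fps_of_poly (s k) * y k)"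
        by (simp add: w_def fps_of_poly_mult algebra_simps)
      also have "\<dots> = fps_of_poly (c k) * z i - fps_of_poly (c i) * z k"
        unfolding sc(3)[OF that] sc(3)[OF k(1)] by (simp add: algebra_simps)
      finally show ?thesis .
    qed
    hence "w i \<in> rspan B" if "i \<in> I - {k}" for i
      using that sc(2) k(1) by (auto intro!: rspan_diff rspan_scale)
    moreover have "finite (I - {k})" "card B < card (I - {k})"
      using insert.prems insert.hyps k by auto
    ultimately obtain d where d: "\<exists>i\<in>I - {k}. d i \<noteq> 0"
        "(\<Sum>i\<in>I - {k}. fps_of_poly (d i) * w i) = 0"
      using insert.IH[of "I - {k}" w] by blast
    \<comment> \<open>The dependence of the \<open>w i\<close> rewritten in terms of the
      \<open>y i\<close>; all contributions of the pivot are collected at index \<open>k\<close>.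
      Away from \<open>k\<close> no factor of \<open>d i * c k * s i\<close> can vanish unless
      \<open>d i\<close> does.\<close>
    define e where "e = (\<lambda>i. if i = k then - (\<Sum>j\<in>I - {k}. d j * c j * s k) else d i * c k * s i)"
    have "(\<Sum>i\<in>I - {k}. fps_of_poly (d i) * w i) =
        (\<Sum>i\<in>I - {k}. fps_of_poly (e i) * y i - fps_of_poly (d i * c i * s k) * y k)"
      by (rule sum.cong) (auto simp: w_def e_def fps_of_poly_mult algebra_simps)
    also have "\<dots> = (\<Sum>i\<in>I - {k}. fps_of_poly (e i) * y i) + fps_of_poly (e k) * y k"
      by (simp add: e_def sum_subtractf sum_distrib_right fps_of_poly_sum fps_of_poly_uminus)
    also have "\<dots> = (\<Sum>i\<in>I. fps_of_poly (e i) * y i)"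
      using k insert.prems by (simp add: sum.remove[of I k])
    finally have "(\<Sum>i\<in>I. fps_of_poly (e i) * y i) = 0" using d(2) by simp
    moreover from d(1) obtain i where "i \<in> I - {k}" "d i \<noteq> 0" by blast
    hence "e i \<noteq> 0" "i \<in> I" using sc(1)[of i] k by (auto simp: e_def)
    ultimately show ?thesis by blast
  qed
qed

text \<open>A finite-dimensional algebra over the rational functions, restricted to its power
  series. It takes the place of a finite field extension: a series is algebraic exactly when it lies
  in such an \<open>R\<close>, and closure properties become membership statements.\<close>

definition fin_alg :: "'a::field fps set \<Rightarrow> bool" where
  "fin_alg R \<longleftrightarrow> (\<exists>B. finite B \<and> R = rspan B) \<and> 1 \<in> R \<and> (\<forall>u\<in>R. \<forall>v\<in>R. u * v \<in> R)"

lemma fin_algE: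
  assumes "fin_alg R"
  obtains B where "finite B" "R = rspan B"
  using assms by (auto simp: fin_alg_def)

lemma fin_alg_one: "fin_alg R \<Longrightarrow> 1 \<in> R"
  and fin_alg_mult: "fin_alg R \<Longrightarrow> u \<in> R \<Longrightarrow> v \<in> R \<Longrightarrow> u * v \<in> R"
  by (auto simp: fin_alg_def)

lemma fin_alg_add: "fin_alg R \<Longrightarrow> u \<in> R \<Longrightarrow> v \<in> R \<Longrightarrow> u + v \<in> R"
  and fin_alg_diff: "fin_alg R \<Longrightarrow> u \<in> R \<Longrightarrow> v \<in> R \<Longrightarrow> u - v \<in> R"
  by (auto simp: fin_alg_def rspan_add rspan_diff)

lemma fin_alg_sum: "fin_alg R \<Longrightarrow> (\<And>i. i \<in> I \<Longrightarrow> f i \<in> R) \<Longrightarrow> sum f I \<in> R"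
  by (auto simp: fin_alg_def intro: rspan_sum)

lemma fin_alg_unscale: "fin_alg R \<Longrightarrow> fps_of_poly p * y \<in> R \<Longrightarrow> p \<noteq> 0 \<Longrightarrow> y \<in> R"
  by (auto simp: fin_alg_def intro: rspan_unscale)

lemma fin_alg_power: "fin_alg R \<Longrightarrow> u \<in> R \<Longrightarrow> u ^ i \<in> R"
  by (induction i) (auto intro: fin_alg_one fin_alg_mult)

lemma fin_alg_scale: "fin_alg R \<Longrightarrow> y \<in> R \<Longrightarrow> fps_of_poly p * y \<in> R"
  by (auto simp: fin_alg_def intro: rspan_scale)

lemma fin_alg_poly: "fin_alg R \<Longrightarrow> fps_of_poly p \<in> R"
  using fin_alg_scale[of R 1 p] fin_alg_one[of R] by simp

lemma fin_alg_eval: "fin_alg R \<Longrightarrow> f \<in> R \<Longrightarrow> poly (map_poly fps_of_poly P) f \<in> R"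
  unfolding poly_altdef
  by (intro fin_alg_sum) (auto simp: coeff_map_poly intro!: fin_alg_mult fin_alg_power fin_alg_poly)

text \<open>A finite-dimensional algebra without zero divisors is a field: a dependence of the powers of
  \<open>v\<close>, with the factor \<open>v ^ k\<close> of lowest order removed, expresses \<open>inverse v\<close> through powers of \<open>v\<close>.\<close>

lemma fin_alg_cancel:
  assumes R: "fin_alg R" and v: "v \<in> R" "v \<noteq> 0" and vy: "v * y \<in> R"
  shows "y \<in> R"
proof -
  obtain B where B: "finite B" "R = rspan B" using R by (rule fin_algE)
  have "\<exists>c. (\<exists>i\<in>{..card B}. c i \<noteq> 0) \<and> (\<Sum>i\<in>{..card B}. fps_of_poly (c i) * v ^ i) = 0"
    by (rule rspan_dependent[OF B(1)]) (use B fin_alg_power[OF R v(1)] in auto)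
  then obtain c where c: "\<exists>i\<le>card B. c i \<noteq> 0" "(\<Sum>i\<le>card B. fps_of_poly (c i) * v ^ i) = 0"
    by auto
  define k where "k = (LEAST i. i \<le> card B \<and> c i \<noteq> 0)"
  have k: "k \<le> card B" "c k \<noteq> 0" using LeastI_ex[OF c(1)] by (auto simp: k_def)
  have less: "c i = 0" if "i < k" for i
    using not_less_Least[of i "\<lambda>i. i \<le> card B \<and> c i \<noteq> 0"] that k by (auto simp: k_def)
  have "0 = (\<Sum>i\<in>{k..card B}. fps_of_poly (c i) * v ^ i)"
    unfolding c(2)[symmetric] by (rule sum.mono_neutral_right) (auto simp: less not_le)
  also have "\<dots> = v ^ k * (\<Sum>i\<in>{k..card B}. fps_of_poly (c i) * v ^ (i - k))"
    by (simp add: sum_distrib_left) (rule sum.cong, auto simp: power_add[symmetric] mult.left_commute)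
  finally have "(\<Sum>i\<in>{k..card B}. fps_of_poly (c i) * v ^ (i - k)) = 0" using v by simp
  moreover have "{k..card B} = insert k {k<..card B}" using k by auto
  ultimately have "fps_of_poly (c k) + (\<Sum>i\<in>{k<..card B}. fps_of_poly (c i) * v ^ (i - k)) = 0"
    by simp
  hence "fps_of_poly (c k) * y = - (\<Sum>i\<in>{k<..card B}. fps_of_poly (c i) * v ^ (i - k)) * y"
    by (simp add: add_eq_0_iff)
  also have "\<dots> = 0 - (\<Sum>i\<in>{k<..card B}. fps_of_poly (c i) * (v ^ (i - k - 1) * (v * y)))"
    by (simp add: sum_distrib_right)
      (rule sum.cong, auto simp: power_Suc2[symmetric] mult.assoc[symmetric] Suc_diff_Suc simp del: power_Suc)
  also have "\<dots> \<in> R"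
    by (intro fin_alg_diff[OF R] fin_alg_sum[OF R] fin_alg_scale[OF R] fin_alg_mult[OF R]
        fin_alg_power[OF R] v vy) (use fin_alg_poly[OF R, of 0] in simp)
  finally show ?thesis using k(2) by (rule fin_alg_unscale[OF R])
qed

lemma poly_fps_of_poly_altdef:
  assumes "degree P \<le> N"
  shows "poly (map_poly fps_of_poly P) f = (\<Sum>i\<le>N. fps_of_poly (coeff P i) * f ^ i)"
proof -
  have "degree (map_poly fps_of_poly P) = degree P" by (rule degree_map_poly) auto
  hence "poly (map_poly fps_of_poly P) f = (\<Sum>i\<le>degree P. fps_of_poly (coeff P i) * f ^ i)"
    by (simp add: poly_altdef coeff_map_poly)
  also have "\<dots> = (\<Sum>i\<le>N. fps_of_poly (coeff P i) * f ^ i)"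
    using assms by (intro sum.mono_neutral_left) (auto simp: coeff_eq_0)
  finally show ?thesis .
qed

lemma algebraic_fpsI:
  assumes "(\<Sum>i\<le>N. fps_of_poly (c i) * f ^ i) = 0" "c i \<noteq> 0" "i \<le> N"
  shows "algebraic_fps f"
proof -
  define P where "P = (\<Sum>i\<le>N. monom (c i) i)"
  have P: "coeff P i = (if i \<le> N then c i else 0)" for i
    by (auto simp: P_def coeff_sum)
  have "degree P \<le> N" by (rule degree_le) (auto simp: P)
  hence "poly (map_poly fps_of_poly P) f = 0"
    using assms(1) by (simp add: poly_fps_of_poly_altdef P)
  moreover have "P \<noteq> 0" using P[of i] assms(2,3) by auto
  ultimately show ?thesis unfolding algebraic_fps_def by blast
qed

text \<open>The powers of \<open>f\<close> up to exponent \<open>card B\<close> all lie in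
  \<open>R\<close> and outnumber its generators, so they are linearly dependent.\<close>

lemma fin_alg_imp_algebraic:
  assumes "fin_alg R" "f \<in> R"
  shows "algebraic_fps f"
proof -
  obtain B where B: "finite B" "R = rspan B" using assms(1) by (rule fin_algE)
  have "\<exists>c. (\<exists>i\<in>{..card B}. c i \<noteq> 0) \<and> (\<Sum>i\<in>{..card B}. fps_of_poly (c i) * f ^ i) = 0"
    by (rule rspan_dependent[OF B(1)]) (use B fin_alg_power[OF assms] in auto)
  thus ?thesis using algebraic_fpsI by auto
qed

lemma fin_alg_powers:
  fixes f :: "'a::field fps"
  assumes P: "P \<noteq> 0" "poly (map_poly fps_of_poly P) f = 0"
  shows "fin_alg (rspan ((\<lambda>i. f ^ i) ` {..<degree P}))" (is "fin_alg ?R")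
    and "f \<in> rspan ((\<lambda>i. f ^ i) ` {..<degree P})"
proof -
  define d where "d = degree P"
  have "d > 0"
  proof (rule ccontr)
    assume "\<not> d > 0"
    then obtain p where "P = [:p:]" by (metis degree_eq_zeroE d_def not_gr0)
    thus False using P by (auto simp: map_poly_pCons)
  qed
  have pow: "f ^ i \<in> ?R" for i
  proof (induction i rule: less_induct)
    case (less i)
    show ?case
    proof (cases "i < d")
      case True
      thus ?thesis by (intro rspan_base) (auto simp: d_def)
    next
      case False
      \<comment> \<open>The equation times \<open>f ^ (i - d)\<close> expresses
        \<open>f ^ i\<close>, up to the leading coefficient of \<open>P\<close>, through smaller
        powers.\<close>
      have "0 = f ^ (i - d) * (\<Sum>j\<le>d. fps_of_poly (coeff P j) * f ^ j)"
        using P(2) by (simp add: poly_fps_of_poly_altdef[of P d] d_def)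
      also have "\<dots> = (\<Sum>j\<le>d. fps_of_poly (coeff P j) * f ^ (i - d + j))"
        by (simp add: sum_distrib_left power_add mult_ac)
      also have "{..d} = insert d {..<d}" by auto
      finally have "fps_of_poly (coeff P d) * f ^ i =
          - (\<Sum>j<d. fps_of_poly (coeff P j) * f ^ (i - d + j))"
        using False by (simp add: eq_neg_iff_add_eq_0)
      also have "\<dots> \<in> ?R"
        using False by (intro rspan_uminus rspan_sum rspan_scale less.IH) auto
      finally show ?thesis using P(1) by (rule_tac rspan_unscale) (auto simp: d_def)
    qed
  qed
  show "fin_alg ?R" unfolding fin_alg_def
  proof (intro conjI ballI)
    show "1 \<in> ?R" using pow[of 0] by simp
    fix u v assume "u \<in> ?R" "v \<in> ?R"
    thus "u * v \<in> ?R"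
      by (rule rspan_mult_closed[rotated]) (auto simp: power_add[symmetric] pow)
  qed auto
  show "f \<in> ?R" using pow[of 1] by simp
qed

lemma algebraic_imp_fin_alg:
  assumes "algebraic_fps f"
  obtains R where "fin_alg R" "f \<in> R"
  using assms fin_alg_powers unfolding algebraic_fps_def by metis

text \<open>The analogue of a compositum: the products of one generator from each algebra span an
  algebra, and since both contain 1 it contains both.\<close>

lemma fin_alg_join:
  assumes R: "fin_alg R" and S: "fin_alg S"
  obtains T where "fin_alg T" "R \<subseteq> T" "S \<subseteq> T"
proof -
  obtain B where B: "finite B" "R = rspan B" using R by (rule fin_algE)
  obtain C where C: "finite C" "S = rspan C" using S by (rule fin_algE)
  define D where "D = (\<lambda>(b, c). b * c) ` (B \<times> C)"
  have D: "finite D" using B C by (auto simp: D_def)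
  have mem: "u * v \<in> rspan D" if "u \<in> R" "v \<in> S" for u v
    using that unfolding B(2) C(2)
    by (rule rspan_mult_closed[rotated]) (auto simp: D_def intro!: rspan_base[OF D[unfolded D_def]])
  have "x * y \<in> rspan D" if "x \<in> D" "y \<in> D" for x y
  proof -
    from that obtain b c b' c' where x: "x = b * c" "y = b' * c'" "b \<in> B" "b' \<in> B" "c \<in> C" "c' \<in> C"
      by (auto simp: D_def)
    hence "b \<in> R" "b' \<in> R" "c \<in> S" "c' \<in> S" using B C by (auto intro: rspan_base)
    hence "(b * b') * (c * c') \<in> rspan D"
      by (intro mem fin_alg_mult[OF R] fin_alg_mult[OF S])
    thus ?thesis by (simp add: x mult_ac)
  qed
  hence "fin_alg (rspan D)"
    unfolding fin_alg_def using D mem[OF fin_alg_one[OF R] fin_alg_one[OF S]]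
    by (auto intro: rspan_mult_closed)
  moreover have "R \<subseteq> rspan D" "S \<subseteq> rspan D"
    using mem[OF _ fin_alg_one[OF S]] mem[OF fin_alg_one[OF R]] by auto
  ultimately show ?thesis using that by blast
qed

section \<open>Closure properties of algebraic series\<close>

lemma algebraic_common_fin_alg:
  assumes "algebraic_fps f" "algebraic_fps g"
  obtains R where "fin_alg R" "f \<in> R" "g \<in> R"
  using assms algebraic_imp_fin_alg fin_alg_join by (metis subsetD)

lemma algebraic_fps_add: "algebraic_fps f \<Longrightarrow> algebraic_fps g \<Longrightarrow> algebraic_fps (f + g)"
  by (metis algebraic_common_fin_alg fin_alg_add fin_alg_imp_algebraic)

lemma algebraic_fps_mult: "algebraic_fps f \<Longrightarrow> algebraic_fps g \<Longrightarrow> algebraic_fps (f * g)"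
  by (metis algebraic_common_fin_alg fin_alg_mult fin_alg_imp_algebraic)

lemma algebraic_fps_cancel:
  assumes "algebraic_fps f" "algebraic_fps (f * g)" "f \<noteq> 0"
  shows "algebraic_fps g"
  by (rule algebraic_common_fin_alg[OF assms(1,2)])
    (meson assms(3) fin_alg_cancel fin_alg_imp_algebraic)

lemma algebraic_fps_of_poly: "algebraic_fps (fps_of_poly p)"
  by (rule algebraic_fpsI[of "\<lambda>i. if i = 0 then p else -1" _ 1 1]) (auto simp: fps_of_poly_uminus)

lemma algebraic_fps_sum: "(\<And>i. i \<in> I \<Longrightarrow> algebraic_fps (f i)) \<Longrightarrow> algebraic_fps (sum f I)"
  using algebraic_fps_of_poly[of 0]
  by (induction I rule: infinite_finite_induct) (auto intro: algebraic_fps_add)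

section \<open>Recurrences for the coefficients of algebraic series\<close>

text \<open>The operator x d/dx. Unlike d/dx it does not shift indices, so differential equations
  turn directly into recurrences.\<close>

definition euler_op :: "'a::comm_ring_1 fps \<Rightarrow> 'a fps" where
  "euler_op f = fps_X * fps_deriv f"

lemma euler_op_nth: "euler_op f $ j = of_nat j * f $ j"
  by (cases j) (auto simp: euler_op_def)

lemma euler_op_power_nth: "(euler_op ^^ i) f $ j = of_nat j ^ i * f $ j"
  by (induction i) (auto simp: euler_op_nth)

lemma euler_op_mult: "euler_op (f * g) = euler_op f * g + f * euler_op g"
  by (simp add: euler_op_def algebra_simps)

lemma euler_op_sum: "euler_op (sum f A) = (\<Sum>i\<in>A. euler_op (f i))"
  by (simp add: euler_op_def fps_deriv_sum sum_distrib_left)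

lemma euler_op_power: "euler_op (f ^ i) = of_nat i * (f ^ (i - 1) * euler_op f)"
  by (simp add: euler_op_def fps_deriv_power fps_of_nat mult_ac)

lemma euler_op_fps_of_poly: "euler_op (fps_of_poly p) = fps_of_poly (pCons 0 (pderiv p))"
  by (simp add: euler_op_def fps_of_poly_pderiv fps_of_poly_pCons mult.commute)

text \<open>The chain rule for P(x, f(x)): the first summand differentiates the coefficients of
  \<open>P\<close>, the second the argument \<open>f\<close>.\<close>

lemma euler_op_eval:
  fixes P :: "'a::field_char_0 poly poly"
  shows "euler_op (poly (map_poly fps_of_poly P) f) =
    poly (map_poly fps_of_poly (map_poly (\<lambda>p. pCons 0 (pderiv p)) P)) f +
    poly (map_poly fps_of_poly (pderiv P)) f * euler_op f"
proof (induction P)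
  case 0
  thus ?case by (simp add: euler_op_def)
next
  case (pCons p P)
  have add: "map_poly fps_of_poly (P + Q) = map_poly fps_of_poly P + map_poly fps_of_poly Q"
    for Q :: "'a poly poly"
    by (rule poly_eqI) (simp add: coeff_map_poly fps_of_poly_add)
  have plus: "euler_op (u + v) = euler_op u + euler_op v" for u v :: "'a fps"
    by (simp add: euler_op_def algebra_simps)
  show ?case
    by (simp add: map_poly_pCons pderiv_pCons add plus euler_op_mult pCons.IH
        euler_op_fps_of_poly algebra_simps)
qed

text \<open>Differentiating the minimal equation \<open>P(x, f) = 0\<close> yields
  \<open>P\<^sub>z(x, f) * euler_op f \<in> R\<close>, where \<open>P\<^sub>z(x, f) \<noteq> 0\<close> by minimality.\<close>

lemma algebraic_imp_euler_closed:
  assumes "algebraic_fps f"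
  obtains R where "fin_alg R" "f \<in> R" "\<And>y. y \<in> R \<Longrightarrow> euler_op y \<in> R"
proof -
  define Q where "Q = (\<lambda>P. P \<noteq> 0 \<and> poly (map_poly fps_of_poly P) f = 0)"
  obtain P where "Q P" "\<And>P'. Q P' \<Longrightarrow> degree P \<le> degree P'"
    using assms ex_has_least_nat[of Q _ degree] unfolding algebraic_fps_def Q_def by metis
  hence P: "P \<noteq> 0" "poly (map_poly fps_of_poly P) f = 0"
    and min: "\<And>P'. P' \<noteq> 0 \<Longrightarrow> poly (map_poly fps_of_poly P') f = 0 \<Longrightarrow> degree P \<le> degree P'"
    unfolding Q_def by blast+
  define B where "B = (\<lambda>i. f ^ i) ` {..<degree P}"
  define R where "R = rspan B"
  have R: "fin_alg R" "f \<in> R" using fin_alg_powers[OF P] by (auto simp: R_def B_def)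
  have "degree P \<noteq> 0"
  proof
    assume "degree P = 0"
    then obtain p where "P = [:p:]" by (metis degree_eq_zeroE)
    thus False using P by (auto simp: map_poly_pCons)
  qed
  hence deg: "degree (pderiv P) < degree P" "pderiv P \<noteq> 0"
    by (auto simp: degree_pderiv pderiv_eq_0_iff)
  define v where "v = poly (map_poly fps_of_poly (pderiv P)) f"
  have "v \<noteq> 0" using min[of "pderiv P"] deg by (auto simp: v_def)
  have "v * euler_op f = 0 - poly (map_poly fps_of_poly (map_poly (\<lambda>p. pCons 0 (pderiv p)) P)) f"
    using euler_op_eval[of P f] P(2) by (simp add: v_def euler_op_def eq_neg_iff_add_eq_0 add.commute)
  also have "\<dots> \<in> R"
    using fin_alg_poly[OF R(1), of 0] by (intro fin_alg_diff[OF R(1)] fin_alg_eval[OF R]) simp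
  finally have f': "euler_op f \<in> R"
    by (rule fin_alg_cancel[OF R(1) _ \<open>v \<noteq> 0\<close>, rotated]) (simp add: v_def fin_alg_eval[OF R])
  have B': "euler_op b \<in> R" if "b \<in> B" for b
  proof -
    from that obtain i where "b = f ^ i" by (auto simp: B_def)
    moreover have "of_nat i * (f ^ (i - 1) * euler_op f) =
        fps_of_poly (of_nat i) * (f ^ (i - 1) * euler_op f)"
      by (simp add: of_nat_poly fps_of_poly_const fps_of_nat)
    ultimately show ?thesis
      by (metis R f' euler_op_power fin_alg_scale fin_alg_mult fin_alg_power)
  qed
  have "euler_op y \<in> R" if y: "y \<in> R" for y
  proof -
    obtain s c where s: "s \<noteq> 0" "fps_of_poly s * y = (\<Sum>b\<in>B. fps_of_poly (c b) * b)"
      using y unfolding R_def by (rule rspanE)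
    \<comment> \<open>The product rule isolates \<open>euler_op y\<close>. The remaining terms
      involve only \<open>y\<close>, the generators and their images under \<open>euler_op\<close>,
      all of which lie in \<open>R\<close>.\<close>
    have "fps_of_poly s * euler_op y = euler_op (fps_of_poly s * y) - euler_op (fps_of_poly s) * y"
      by (simp add: euler_op_mult)
    also have "euler_op (fps_of_poly s * y) =
        (\<Sum>b\<in>B. euler_op (fps_of_poly (c b)) * b + fps_of_poly (c b) * euler_op b)"
      by (simp only: s(2) euler_op_sum euler_op_mult)
    also have "\<dots> - euler_op (fps_of_poly s) * y \<in> R"
      unfolding euler_op_fps_of_poly
      using B' y R(1)
      by (intro fin_alg_diff fin_alg_sum fin_alg_add fin_alg_scale)
        (auto simp: R_def B_def intro: rspan_base)
    finally show ?thesis using s(1) by (rule fin_alg_unscale[OF R(1)])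
  qed
  thus ?thesis using that R by blast
qed

text \<open>The iterates of \<open>euler_op\<close> on \<open>f\<close> stay in a finite-dimensional
  algebra, so they satisfy a linear relation with polynomial coefficients. Comparing coefficients of
  powers of x in this differential equation gives the recurrence.\<close>

lemma algebraic_imp_P_recursive:
  assumes "algebraic_fps f"
  obtains L P where "\<exists>s\<le>L. P s \<noteq> (0::complex poly)"
    "\<And>M. (\<Sum>s\<le>L. poly (P s) (of_nat M) * f $ (M + s)) = 0"
proof -
  obtain R where R: "fin_alg R" "f \<in> R" "\<And>y. y \<in> R \<Longrightarrow> euler_op y \<in> R"
    using assms by (rule algebraic_imp_euler_closed) blast
  obtain B where B: "finite B" "R = rspan B" using R(1) by (rule fin_algE)
  have pow: "(euler_op ^^ i) f \<in> R" for i by (induction i) (auto simp: R)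
  define D where "D = card B"
  have "\<exists>c. (\<exists>i\<in>{..D}. c i \<noteq> 0) \<and> (\<Sum>i\<in>{..D}. fps_of_poly (c i) * (euler_op ^^ i) f) = 0"
    by (rule rspan_dependent[OF B(1)]) (use B pow in \<open>auto simp: D_def\<close>)
  then obtain c k where c: "k \<le> D" "c k \<noteq> 0"
      "(\<Sum>i\<le>D. fps_of_poly (c i) * (euler_op ^^ i) f) = 0"
    by auto
  define L where "L = Max ((\<lambda>i. degree (c i)) ` {..D})"
  have L: "degree (c i) \<le> L" if "i \<le> D" for i
    using that by (auto simp: L_def intro!: Max_ge)
  \<comment> \<open>The differential operator sorted by powers of x: \<open>p l\<close> is the
    coefficient of x^l, a polynomial in x d/dx.\<close>
  define p where "p = (\<lambda>l. \<Sum>i\<le>D. monom (coeff (c i) l) i)"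
  have p: "poly (p l) x = (\<Sum>i\<le>D. coeff (c i) l * x ^ i)" for l x
    by (simp add: p_def poly_sum poly_monom)
  have p0: "(\<Sum>l\<le>L. poly (p l) (of_nat (N - l)) * f $ (N - l)) = 0" if "L \<le> N" for N
  proof -
    have "0 = (\<Sum>i\<le>D. fps_of_poly (c i) * (euler_op ^^ i) f) $ N" by (simp add: c(3))
    also have "\<dots> = (\<Sum>i\<le>D. \<Sum>l\<le>N. coeff (c i) l * (of_nat (N - l) ^ i * f $ (N - l)))"
      by (simp add: fps_sum_nth fps_mult_nth euler_op_power_nth atLeast0AtMost)
    also have "\<dots> = (\<Sum>i\<le>D. \<Sum>l\<le>L. coeff (c i) l * (of_nat (N - l) ^ i * f $ (N - l)))"
    proof (rule sum.cong[OF refl], rule sum.mono_neutral_right)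
      fix i assume i: "i \<in> {..D}"
      show "\<forall>l\<in>{..N} - {..L}. coeff (c i) l * (of_nat (N - l) ^ i * f $ (N - l)) = 0"
        using L[of i] i by (auto intro: coeff_eq_0)
    qed (use that in auto)
    also have "\<dots> = (\<Sum>l\<le>L. poly (p l) (of_nat (N - l)) * f $ (N - l))"
      unfolding p sum_distrib_right by (subst sum.swap) (simp only: mult.assoc)
    finally show ?thesis by simp
  qed
  \<comment> \<open>The relation is reindexed by N = M + L and s = L - l, which also secures
    \<open>L \<le> N\<close>. Composing with X + s turns a polynomial in the index M + s into one in
    M.\<close>
  define P where "P = (\<lambda>s. pcompose (p (L - s)) [:of_nat s, 1:])"
  show thesis
  proof
    show "(\<Sum>s\<le>L. poly (P s) (of_nat M) * f $ (M + s)) = 0" for M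
    proof -
      have "(\<Sum>s\<le>L. poly (P s) (of_nat M) * f $ (M + s)) =
          (\<Sum>l\<le>L. poly (p l) (of_nat (M + L - l)) * f $ (M + L - l))"
        by (rule sum.reindex_bij_witness[of _ "\<lambda>l. L - l" "\<lambda>l. L - l"])
          (auto simp: P_def poly_pcompose add.commute)
      thus ?thesis using p0[of "M + L"] by simp
    qed
    \<comment> \<open>The leading coefficient of the nonzero \<open>c k\<close> reappears as the
      coefficient of degree \<open>k\<close> in \<open>p l\<close>, so the recurrence is not
      trivial.\<close>
    define l where "l = degree (c k)"
    have "coeff (p l) k = coeff (c k) l" using c(1) by (simp add: p_def coeff_sum)
    hence "p l \<noteq> 0" using c(2) by (auto simp: l_def)
    moreover have "l \<le> L" using L[OF c(1)] by (simp add: l_def)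
    ultimately show "\<exists>s\<le>L. P s \<noteq> 0"
      by (intro exI[of _ "L - l"]) (auto simp: P_def pcompose_eq_0_iff)
  qed
qed

text \<open>The operator \<open>E - \<mu> k\<close> (\<open>E\<close> the shift) lowers the degree of the \<open>k\<close>-th coefficient and
  preserves the degrees of the others.\<close>

lemma exp_poly_independent:
  fixes t :: "'i \<Rightarrow> 'a::field_char_0 poly"
  assumes "finite S" "inj_on \<mu> S" "\<And>i. i \<in> S \<Longrightarrow> \<mu> i \<noteq> 0"
    and "\<And>M. (\<Sum>i\<in>S. poly (t i) (of_nat M) * \<mu> i ^ M) = 0"
  shows "\<forall>i\<in>S. t i = 0"
  using assms(4)
\<comment> \<open>The successor in the measure distinguishes a nonzero constant from 0, so that
  killing a constant coefficient also counts as progress.\<close>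
proof (induction "\<Sum>i\<in>S. if t i = 0 then 0 else Suc (degree (t i))" arbitrary: t rule: less_induct)
  case less
  show ?case
  proof (rule ccontr)
    assume "\<not> ?thesis"
    then obtain k where k: "k \<in> S" "t k \<noteq> 0" by auto
    define sh where "sh = (\<lambda>p::'a poly. pcompose p [:1, 1:])"
    define T where "T = (\<lambda>i. smult (\<mu> i) (sh (t i)) - smult (\<mu> k) (t i))"
    have sh: "degree (sh p) = degree p" "lead_coeff (sh p) = lead_coeff p" for p
      unfolding sh_def by (simp add: degree_pcompose) (subst lead_coeff_comp, auto)
    have shc: "coeff (sh p) (degree p) = coeff p (degree p)" for p
      using sh(2)[of p] unfolding sh(1) .
    have degT: "degree (T i) \<le> degree (t i)" for i
      unfolding T_def by (intro degree_diff_le order.trans[OF degree_smult_le]) (auto simp: sh)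
    have cT: "coeff (T i) (degree (t i)) = (\<mu> i - \<mu> k) * coeff (t i) (degree (t i))" for i
      by (simp add: T_def shc algebra_simps)
    have T0: "T i = 0" if "t i = 0" for i using that by (simp add: T_def sh_def)
    have Tk: "T k = 0 \<or> degree (T k) < degree (t k)"
      using degT[of k] cT[of k] by (metis diff_self leading_coeff_0_iff le_neq_implies_less mult_zero_left)
    have Tne: "T i \<noteq> 0" "degree (T i) = degree (t i)" if "i \<in> S" "i \<noteq> k" "t i \<noteq> 0" for i
    proof -
      have "coeff (T i) (degree (t i)) \<noteq> 0"
        using cT[of i] that k(1) assms(2) by (auto simp: inj_on_def)
      thus "T i \<noteq> 0" "degree (T i) = degree (t i)"
        using degT[of i] le_degree[of "T i" "degree (t i)"] by auto
    qed
    have "\<forall>i\<in>S. T i = 0"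
    proof (rule less.hyps)
      show "(\<Sum>i\<in>S. if T i = 0 then 0 else Suc (degree (T i))) <
          (\<Sum>i\<in>S. if t i = 0 then 0 else Suc (degree (t i)))"
      proof (rule sum_strict_mono_ex1[OF assms(1)])
        show "\<forall>i\<in>S. (if T i = 0 then 0 else Suc (degree (T i))) \<le>
            (if t i = 0 then 0 else Suc (degree (t i)))"
          using degT T0 by auto
        show "\<exists>i\<in>S. (if T i = 0 then 0 else Suc (degree (T i))) <
            (if t i = 0 then 0 else Suc (degree (t i)))"
          using k Tk by (intro bexI[of _ k]) auto
      qed
      fix M
      have "(\<Sum>i\<in>S. poly (T i) (of_nat M) * \<mu> i ^ M) =
          (\<Sum>i\<in>S. poly (t i) (of_nat (Suc M)) * \<mu> i ^ Suc M) -
          \<mu> k * (\<Sum>i\<in>S. poly (t i) (of_nat M) * \<mu> i ^ M)"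
        by (simp add: T_def sh_def poly_pcompose sum_distrib_left algebra_simps flip: sum_subtractf)
      thus "(\<Sum>i\<in>S. poly (T i) (of_nat M) * \<mu> i ^ M) = 0"
        using less.prems[of M] less.prems[of "Suc M"] by simp
    qed
    \<comment> \<open>Only the term of index \<open>k\<close> survives, so \<open>t k\<close> would
      vanish at every natural number.\<close>
    hence "t i = 0" if "i \<in> S" "i \<noteq> k" for i using Tne that by blast
    hence eq: "(\<Sum>i\<in>S. poly (t i) (of_nat M) * \<mu> i ^ M) = poly (t k) (of_nat M) * \<mu> k ^ M" for M
      using k(1) assms(1) by (subst sum.remove[of _ k]) auto
    have "poly (t k) (of_nat M) = 0" for M
      using less.prems[of M] assms(3)[OF k(1)] by (simp add: eq)
    hence "range of_nat \<subseteq> {x. poly (t k) x = 0}" by auto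
    moreover have "infinite (range (of_nat :: nat \<Rightarrow> 'a))"
      by (rule range_inj_infinite) (rule inj_of_nat)
    ultimately show False using poly_roots_finite[OF k(2)] finite_subset by blast
  qed
qed

text \<open>Replacing each f(M + s) in the recurrence by f(M) times a rational function of q^M and
  clearing denominators gives a polynomial identity in M and q^M. Its top power of q^M comes from
  the last nonzero \<open>P s\<close> alone, because \<open>degree B < degree A\<close>.\<close>

lemma q_hypergeometric_not_algebraic:
  fixes A B :: "complex poly" and q :: complex
  assumes deg: "degree B < degree A" and B0: "B \<noteq> 0"
    and q: "q \<noteq> 0" "\<And>m. m > 0 \<Longrightarrow> q ^ m \<noteq> 1"
    and u: "\<And>j. f $ j \<noteq> 0"
    and rec: "\<And>j. poly B (q ^ j) * f $ (Suc j) = poly A (q ^ j) * f $ j"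
  shows "\<not> algebraic_fps f"
proof
  assume "algebraic_fps f"
  then obtain L P where P: "\<exists>s\<le>L. P s \<noteq> (0::complex poly)"
      "\<And>M. (\<Sum>s\<le>L. poly (P s) (of_nat M) * f $ (M + s)) = 0"
    by (rule algebraic_imp_P_recursive) blast
  have A0: "A \<noteq> 0" using deg by auto
  \<comment> \<open>\<open>sc p i\<close> is p(q^i Y), whose value at Y = q^M is p(q^(M +
    i)).\<close>
  define sc where "sc = (\<lambda>p i. pcompose p [:0, q ^ i:])"
  have sc0: "sc p i \<noteq> 0" if "p \<noteq> 0" for p i
    using that q(1) by (auto simp: sc_def pcompose_eq_0_iff)
  \<comment> \<open>\<open>T s\<close> is the ratio f(M + s) / f(M) times the common denominator of
    all \<open>L\<close> shifts, as a polynomial in Y = q^M. Its degree increases strictly with s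
    for s up to \<open>L\<close>.\<close>
  define T where "T = (\<lambda>s. (\<Prod>i<s. sc A i) * (\<Prod>i\<in>{s..<L}. sc B i))"
  have T0: "T s \<noteq> 0" for s using sc0 A0 B0 by (simp add: T_def)
  have degT: "degree (T s) = s * degree A + (L - s) * degree B" for s
  proof -
    have "degree (T s) = degree (\<Prod>i<s. sc A i) + degree (\<Prod>i\<in>{s..<L}. sc B i)"
      unfolding T_def using sc0 A0 B0 by (intro degree_mult_eq) auto
    also have "degree (\<Prod>i<s. sc A i) = (\<Sum>i<s. degree (sc A i))"
      using sc0 A0 by (intro degree_prod_eq_sum_degree) auto
    also have "degree (\<Prod>i\<in>{s..<L}. sc B i) = (\<Sum>i\<in>{s..<L}. degree (sc B i))"
      using sc0 B0 by (intro degree_prod_eq_sum_degree) auto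
    finally show ?thesis using q(1) by (simp add: sc_def degree_pcompose)
  qed
  have fs: "f $ (M + s) * (\<Prod>i<s. poly (sc B i) (q ^ M)) = f $ M * (\<Prod>i<s. poly (sc A i) (q ^ M))"
    for M s
  proof (induction s)
    case (Suc s)
    have "f $ (M + Suc s) * (\<Prod>i<Suc s. poly (sc B i) (q ^ M)) =
        (poly B (q ^ (M + s)) * f $ Suc (M + s)) * (\<Prod>i<s. poly (sc B i) (q ^ M))"
      by (simp add: sc_def poly_pcompose power_add mult_ac)
    also have "\<dots> = poly A (q ^ (M + s)) * (f $ (M + s) * (\<Prod>i<s. poly (sc B i) (q ^ M)))"
      unfolding rec by (simp add: mult_ac)
    also have "\<dots> = f $ M * (\<Prod>i<Suc s. poly (sc A i) (q ^ M))"
      unfolding Suc.IH by (simp add: sc_def poly_pcompose power_add mult_ac)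
    finally show ?case .
  qed simp
  have main: "(\<Sum>s\<le>L. poly (P s) (of_nat M) * poly (T s) (q ^ M)) = 0" for M
  proof -
    \<comment> \<open>Denominators are only multiplied up, so zeros of \<open>B\<close> at powers of
      q do no harm; the only quantity cancelled later is \<open>f $ M\<close>.\<close>
    have "f $ M * poly (T s) (q ^ M) = f $ (M + s) * (\<Prod>i<L. poly (sc B i) (q ^ M))" if "s \<le> L" for s
    proof -
      have "f $ M * poly (T s) (q ^ M) =
          (f $ M * (\<Prod>i<s. poly (sc A i) (q ^ M))) * (\<Prod>i\<in>{s..<L}. poly (sc B i) (q ^ M))"
        by (simp add: T_def poly_prod mult_ac)
      also have "\<dots> = f $ (M + s) * ((\<Prod>i<s. poly (sc B i) (q ^ M)) * (\<Prod>i\<in>{s..<L}. poly (sc B i) (q ^ M)))"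
        unfolding fs[symmetric] by (simp add: mult_ac)
      also have "(\<Prod>i<s. poly (sc B i) (q ^ M)) * (\<Prod>i\<in>{s..<L}. poly (sc B i) (q ^ M)) =
          (\<Prod>i<L. poly (sc B i) (q ^ M))"
        using that by (subst prod.union_disjoint[symmetric]) (auto simp: ivl_disj_un)
      finally show ?thesis .
    qed
    hence "f $ M * (\<Sum>s\<le>L. poly (P s) (of_nat M) * poly (T s) (q ^ M)) =
        (\<Sum>s\<le>L. poly (P s) (of_nat M) * (f $ (M + s) * (\<Prod>i<L. poly (sc B i) (q ^ M))))"
      unfolding sum_distrib_left by (intro sum.cong) (auto simp: mult.left_commute[of "f $ M"])
    also have "\<dots> = (\<Sum>s\<le>L. poly (P s) (of_nat M) * f $ (M + s)) * (\<Prod>i<L. poly (sc B i) (q ^ M))"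
      unfolding sum_distrib_right by (simp only: mult.assoc)
    finally show ?thesis using u[of M] by (simp add: P(2))
  qed
  define N where "N = L * degree A + L * degree B"
  have degN: "degree (T s) \<le> N" if "s \<le> L" for s
    using that unfolding degT N_def by (intro add_mono mult_right_mono) auto
  \<comment> \<open>\<open>t l\<close> is the coefficient of Y^l in the sum of the products
    \<open>P s * T s\<close>; the numbers q^l are distinct because q is not a root of unity.\<close>
  define t where "t = (\<lambda>l. \<Sum>s\<le>L. smult (coeff (T s) l) (P s))"
  have "\<forall>l\<in>{..N}. t l = 0"
  proof (rule exp_poly_independent[of "{..N}" "\<lambda>l. q ^ l"])
    show "inj_on (\<lambda>l. q ^ l) {..N}"
    proof (rule linorder_inj_onI')
      fix i j :: nat assume "i < j"
      hence "q ^ j = q ^ i * q ^ (j - i)" by (simp flip: power_add)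
      thus "q ^ i \<noteq> q ^ j" using q \<open>i < j\<close> by auto
    qed
    fix M
    have "0 = (\<Sum>s\<le>L. poly (P s) (of_nat M) * (\<Sum>l\<le>N. coeff (T s) l * (q ^ M) ^ l))"
      unfolding main[of M, symmetric]
      by (intro sum.cong refl arg_cong2[of _ _ _ _ "(*)"])
        (auto simp: poly_altdef intro!: sum.mono_neutral_left intro: le_degree order.trans[OF _ degN])
    also have "\<dots> = (\<Sum>l\<le>N. poly (t l) (of_nat M) * (q ^ l) ^ M)"
      unfolding sum_distrib_left
      by (subst sum.swap)
        (simp add: t_def poly_sum sum_distrib_right mult.assoc mult.left_commute mult.commute[of _ M] flip: power_mult)
    finally show "(\<Sum>l\<le>N. poly (t l) (of_nat M) * (q ^ l) ^ M) = 0" by simp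
  qed (use q in auto)
  moreover define k where "k = (GREATEST s. s \<le> L \<and> P s \<noteq> 0)"
  have k: "k \<le> L" "P k \<noteq> 0"
    using GreatestI_ex_nat[of "\<lambda>s. s \<le> L \<and> P s \<noteq> 0" L] P(1) by (auto simp: k_def)
  have k': "P s = 0" if "s \<le> L" "s > k" for s
    using Greatest_le_nat[of "\<lambda>s. s \<le> L \<and> P s \<noteq> 0" s L] that by (auto simp: k_def)
  have "t (degree (T k)) = smult (coeff (T k) (degree (T k))) (P k)"
  proof -
    have "smult (coeff (T s) (degree (T k))) (P s) = 0" if "s \<le> L" "s \<noteq> k" for s
    proof (cases "s < k")
      case True
      have "L - s = (L - k) + (k - s)" using True k by simp
      hence "degree (T s) = s * degree A + (L - k) * degree B + (k - s) * degree B"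
        unfolding degT by (simp add: add_mult_distrib)
      moreover have "degree (T k) = s * degree A + (L - k) * degree B + (k - s) * degree A"
      proof -
        have "k = s + (k - s)" using True by simp
        thus ?thesis unfolding degT by (metis add.commute add.left_commute add_mult_distrib)
      qed
      moreover have "(k - s) * degree B < (k - s) * degree A" using True deg by simp
      ultimately show ?thesis by (simp add: coeff_eq_0)
    qed (use k' that in auto)
    hence "(\<Sum>s\<in>{..L} - {k}. smult (coeff (T s) (degree (T k))) (P s)) = 0"
      by (intro sum.neutral) auto
    thus ?thesis unfolding t_def using k(1) by (subst sum.remove[of _ k]) auto
  qed
  ultimately show False using degN[OF k(1)] k(2) T0[of k] by simp
qed

section \<open>Gaussian binomial coefficients\<close>

text \<open>The q-Pascal recursion involves no division, so it makes sense at roots of unity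
  too.\<close>

fun gauss :: "'a::comm_ring_1 \<Rightarrow> nat \<Rightarrow> nat \<Rightarrow> 'a" where
  "gauss x n 0 = 1"
| "gauss x 0 (Suc k) = 0"
| "gauss x (Suc n) (Suc k) = gauss x n k + x ^ Suc k * gauss x n (Suc k)"

lemma gauss_eq_0: "n < k \<Longrightarrow> gauss x n k = 0"
  by (induction x n k rule: gauss.induct) auto

lemma gauss_same: "gauss x n n = 1"
  by (induction n) (auto simp: gauss_eq_0)

text \<open>The law for \<open>g\<close> holds both for the q-numbers 1 + ... + x^(i - 1) and for 1
  - x^i. The former link \<open>gauss\<close> to \<open>q_factorial\<close>-style quotients such as
  \<open>q_binomial\<close>, the latter to \<open>q_poch\<close>.\<close>

lemma gauss_mult_prods:
  fixes g :: "nat \<Rightarrow> 'a::comm_ring_1"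
  assumes g: "\<And>m k. g (k + m) = g k + x ^ k * g m"
  defines "F \<equiv> (\<lambda>m. \<Prod>i=1..m. g i)"
  shows "gauss x (m + k) k * (F k * F m) = F (m + k)"
proof (induction k arbitrary: m)
  case 0
  thus ?case by (simp add: F_def)
next
  case (Suc k)
  have F: "F (Suc i) = g (Suc i) * F i" for i by (simp add: F_def mult.commute)
  show ?case
  proof (induction m)
    case 0
    thus ?case by (simp add: gauss_same gauss_eq_0 F_def)
  next
    case (Suc m)
    \<comment> \<open>\<open>Suc.IH\<close> now denotes the inner hypothesis, so the outer one is
      recalled by its statement. Together they treat the two terms of the Pascal recursion.\<close>
    note IH1 = Suc.IH and IH2 = \<open>\<And>m. gauss x (m + k) k * (F k * F m) = F (m + k)\<close>
    have "gauss x (Suc m + Suc k) (Suc k) * (F (Suc k) * F (Suc m)) =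
        g (Suc k) * (gauss x (Suc m + k) k * (F k * F (Suc m))) +
        x ^ Suc k * g (Suc m) * (gauss x (m + Suc k) (Suc k) * (F (Suc k) * F m))"
      by (simp add: F algebra_simps)
    also have "\<dots> = g (Suc k + Suc m) * F (Suc m + k)"
      unfolding IH1 IH2 g by (simp add: algebra_simps)
    finally show ?case by (simp add: F add.commute)
  qed
qed

lemma poly_of_int_hom:
  fixes q :: "'a::comm_ring_1"
  shows "poly (map_poly of_int (p + r)) q = poly (map_poly of_int p) q + poly (map_poly of_int r) q"
    and "poly (map_poly of_int (p * r)) q = poly (map_poly of_int p) q * poly (map_poly of_int r) q"
proof -
  have add: "poly (map_poly of_int (p + r)) q = poly (map_poly of_int p) q + poly (map_poly of_int r) q"
    for p r
    unfolding poly_add[symmetric]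
    by (rule arg_cong[of _ _ "\<lambda>p. poly p q"], rule poly_eqI) (simp add: coeff_map_poly)
  show "poly (map_poly of_int (p + r)) q = poly (map_poly of_int p) q + poly (map_poly of_int r) q"
    by (rule add)
  have smult: "poly (map_poly of_int (smult c r)) q = of_int c * poly (map_poly of_int r) q" for c
    unfolding poly_smult[symmetric]
    by (rule arg_cong[of _ _ "\<lambda>p. poly p q"], rule poly_eqI) (simp add: coeff_map_poly)
  show "poly (map_poly of_int (p * r)) q = poly (map_poly of_int p) q * poly (map_poly of_int r) q"
    by (induction p) (simp_all add: add smult map_poly_pCons algebra_simps)
qed

lemma poly_gauss:
  "poly (map_poly of_int (gauss (monom 1 1) n k)) q = gauss (q :: 'a::comm_ring_1) n k"
proof -
  have pow: "poly (map_poly of_int (monom 1 1 ^ i)) x = x ^ i" for x :: 'a and i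
    by (induction i) (auto simp: poly_of_int_hom map_poly_monom poly_monom)
  show ?thesis
    by (induction q n k rule: gauss.induct)
      (auto simp: poly_of_int_hom pow simp del: power_Suc One_nat_def)
qed

text \<open>The factorials are cancelled in the integer polynomial ring, where they are nonzero, and
  only then is q inserted; hence roots of unity are covered.\<close>

lemma q_binomial_at_eq_gauss:
  assumes "k \<le> n"
  shows "q_binomial_at q n k = gauss q n k"
proof -
  define x where "x = (monom 1 1 :: int poly)"
  have "x ^ i = monom 1 i" for i
    by (simp add: x_def monom_power)
  hence "gauss x ((n - k) + k) k * (q_fact k * q_fact (n - k)) = q_fact ((n - k) + k)"
    unfolding q_fact_def by (intro gauss_mult_prods) (simp only: q_number_add)
  hence "gauss x n k * (q_fact k * q_fact (n - k)) = q_binomial n k * (q_fact k * q_fact (n - k))"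
    using assms by (simp add: q_binomial_mult_q_fact)
  hence "q_binomial n k = gauss x n k" by (simp add: q_fact_nonzero)
  thus ?thesis by (simp only: q_binomial_at_def x_def poly_gauss)
qed

section \<open>q-Pochhammer products and the q-Lucas theorem\<close>

definition q_poch :: "'a::comm_ring_1 \<Rightarrow> nat \<Rightarrow> 'a" where
  "q_poch q m = (\<Prod>i=1..m. 1 - q ^ i)"

lemma gauss_mult_q_poch: "gauss q (m + k) k * (q_poch q k * q_poch q m) = q_poch q (m + k)"
  unfolding q_poch_def by (rule gauss_mult_prods) (simp add: power_add algebra_simps)

lemma q_poch_nonzero:
  fixes q :: "'a::idom"
  shows "(\<And>i. 0 < i \<Longrightarrow> i \<le> m \<Longrightarrow> q ^ i \<noteq> 1) \<Longrightarrow> q_poch q m \<noteq> 0"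
  by (auto simp: q_poch_def)

text \<open>Induction along the q-Pascal recursion, split by whether the residues of
  \<open>n\<close> and \<open>l\<close> carry over at \<open>m\<close>. A carry in both yields the
  ordinary Pascal rule for the quotients.\<close>

lemma q_Lucas:
  fixes q :: "'a::idom"
  assumes m: "m > 0" "q ^ m = 1" and prim: "\<And>i. 0 < i \<Longrightarrow> i < m \<Longrightarrow> q ^ i \<noteq> 1"
  shows "gauss q n k = of_nat ((n div m) choose (k div m)) * gauss q (n mod m) (k mod m)"
proof (induction n arbitrary: k)
  case 0
  show ?case
    using m(1) by (cases "k < m"; cases k) (auto simp: binomial_eq_0 div_greater_zero_iff)
next
  case (Suc n)
  \<comment> \<open>In \<open>q_poch q m\<close> the factor of index \<open>m\<close> is 0, whereas
    the two shorter products have no zero factor.\<close>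
  have vanish: "gauss q m l = 0" if "0 < l" "l < m" for l
  proof -
    have "q_poch q m = 0" using m by (auto simp: q_poch_def)
    moreover have "q_poch q l \<noteq> 0" "q_poch q (m - l) \<noteq> 0"
      using that prim by (auto intro!: q_poch_nonzero)
    ultimately show ?thesis using gauss_mult_q_poch[of q "m - l" l] that by auto
  qed
  show ?case
  proof (cases k)
    case 0
    thus ?thesis by simp
  next
    case k: (Suc l)
    have qk: "q ^ i = q ^ (i mod m)" for i
    proof -
      have "q ^ i = q ^ (m * (i div m) + i mod m)" by simp
      also have "\<dots> = q ^ (i mod m)" unfolding power_add power_mult m(2) by simp
      finally show ?thesis .
    qed
    have rec: "gauss q (Suc n) (Suc l) =
        of_nat ((n div m) choose (l div m)) * gauss q (n mod m) (l mod m) +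
        q ^ (Suc l mod m) *
          (of_nat ((n div m) choose (Suc l div m)) * gauss q (n mod m) (Suc l mod m))"
      by (simp only: gauss.simps Suc.IH[of l] Suc.IH[of "Suc l"] qk[of "Suc l"])
    have nm: "Suc (n mod m) \<le> m" "Suc (l mod m) \<le> m"
      using m(1) by (auto simp: Suc_le_eq)
    have S: "Suc i mod m = (if Suc (i mod m) = m then 0 else Suc (i mod m))"
        "Suc i div m = (if Suc (i mod m) = m then Suc (i div m) else i div m)" for i
      by (auto simp: mod_Suc div_Suc)
    consider (a) "Suc (n mod m) < m" "Suc (l mod m) < m" | (b) "Suc (n mod m) < m" "Suc (l mod m) = m"
      | (c) "Suc (n mod m) = m" "Suc (l mod m) < m" | (d) "Suc (n mod m) = m" "Suc (l mod m) = m"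
      using nm by linarith
    thus ?thesis
    proof cases
      case a
      thus ?thesis
        unfolding k rec by (simp add: S algebra_simps)
    next
      case b
      thus ?thesis
        unfolding k rec by (simp add: S gauss_eq_0)
    next
      case c
      \<comment> \<open>With a carry in \<open>n\<close> only, the residue terms combine to an inner
        entry of row \<open>m\<close>, which vanishes; the other side contains
        \<open>gauss q 0\<close> at a positive index.\<close>
      have "gauss q (n mod m) (l mod m) + q ^ Suc (l mod m) * gauss q (n mod m) (Suc (l mod m)) =
          gauss q (Suc (n mod m)) (Suc (l mod m))"
        by simp
      also have "\<dots> = 0" using c vanish by simp
      finally have *: "gauss q (n mod m) (l mod m) + q ^ Suc (l mod m) * gauss q (n mod m) (Suc (l mod m)) = 0" .
      have "gauss q (Suc n) k = of_nat ((n div m) choose (l div m)) *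
          (gauss q (n mod m) (l mod m) + q ^ Suc (l mod m) * gauss q (n mod m) (Suc (l mod m)))"
        using c unfolding k rec by (simp add: S algebra_simps)
      thus ?thesis using c unfolding * by (simp add: k S)
    next
      case d
      hence "n mod m = l mod m" by simp
      with d show ?thesis
        unfolding k rec by (simp add: S gauss_same)
    qed
  qed
qed

section \<open>The case where q is not a root of unity\<close>

lemma q_poch_add: "q_poch q (m + d) = q_poch q m * (\<Prod>i=1..d. 1 - q ^ (m + i))"
  by (induction d) (simp_all add: q_poch_def)

lemma gauss_series_not_algebraic:
  fixes n k a b :: nat and q :: complex
  assumes "k \<le> n" "b < a" "0 < b" and q: "q \<noteq> 0" "\<And>m. m > 0 \<Longrightarrow> q ^ m \<noteq> 1"
  shows "\<not> algebraic_fps (Abs_fps (\<lambda>j. gauss q (n + a * j) (k + b * j)))"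
proof -
  define c where "c = a - b"
  have c: "a = b + c" "c > 0" using assms by (auto simp: c_def)
  \<comment> \<open>\<open>pr m d\<close> is the ratio of \<open>q_poch\<close> at m + d (j + 1) and
    at m + d j, as a polynomial of degree d^2 in Y = q^j. The degrees compare as b^2 + c^2 < (b +
    c)^2 = a^2.\<close>
  define pr where "pr = (\<lambda>m d. \<Prod>i=1..d. 1 - monom (q ^ (m + i)) d)"
  have pr: "poly (pr m d) (q ^ j) * q_poch q (m + d * j) = q_poch q (m + d * Suc j)" for m d j
  proof -
    have "poly (pr m d) (q ^ j) = (\<Prod>i=1..d. 1 - q ^ (m + d * j + i))"
      unfolding pr_def poly_prod
      by (rule prod.cong) (auto simp: poly_monom power_add mult_ac simp flip: power_mult)
    thus ?thesis using q_poch_add[of q "m + d * j" d] by (simp add: algebra_simps)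
  qed
  have factor: "degree (1 - monom (q ^ (m + i)) d) = d" if "d > 0" for m i d :: nat
  proof -
    have "degree (1 - monom (q ^ (m + i)) d) = degree (monom (q ^ (m + i)) d - 1)"
      by (metis degree_minus minus_diff_eq)
    also have "\<dots> = degree (monom (q ^ (m + i)) d + - 1)" by simp
    also have "\<dots> = degree (monom (q ^ (m + i)) d)"
      using that q(1) by (intro degree_add_eq_left) (simp add: degree_monom_eq)
    finally show ?thesis using q(1) by (simp add: degree_monom_eq)
  qed
  have ne: "1 - monom (q ^ (m + i)) d \<noteq> 0" if "d > 0" for m i d :: nat
    using factor[OF that, of m i] that by auto
  have deg: "degree (pr m d) = d * d" if "d > 0" for m d
    unfolding pr_def by (subst degree_prod_eq_sum_degree, use ne[OF that] in blast) (simp add: factor[OF that])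
  have pr0: "pr m d \<noteq> 0" if "d > 0" for m d
    using ne[OF that] by (simp only: pr_def prod_zero_iff finite_atLeastAtMost) blast
  have D: "q_poch q m \<noteq> 0" for m using q by (intro q_poch_nonzero) auto
  define f where "f = Abs_fps (\<lambda>j. gauss q (n + a * j) (k + b * j))"
  have f: "f $ j * (q_poch q (k + b * j) * q_poch q (n - k + c * j)) = q_poch q (n + a * j)" for j
  proof -
    have "n - k + c * j + (k + b * j) = n + a * j"
      using assms(1) by (simp add: c algebra_simps)
    thus ?thesis
      using gauss_mult_q_poch[of q "n - k + c * j" "k + b * j"] by (simp add: f_def)
  qed
  have "\<not> algebraic_fps f"
  proof (rule q_hypergeometric_not_algebraic[where B = "pr k b * pr (n - k) c" and A = "pr n a" and q = q])
    have "degree (pr k b * pr (n - k) c) = b * b + c * c"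
      using deg pr0 c assms by (subst degree_mult_eq) auto
    also have "\<dots> < degree (pr n a)"
      using deg[of a] assms c by (simp add: algebra_simps)
    finally show "degree (pr k b * pr (n - k) c) < degree (pr n a)" .
    show "pr k b * pr (n - k) c \<noteq> 0" using pr0 assms c by simp
    show "f $ j \<noteq> 0" for j using f[of j] D by (metis mult_zero_left)
    fix j
    have "(poly (pr k b * pr (n - k) c) (q ^ j) * f $ Suc j) *
        (q_poch q (k + b * j) * q_poch q (n - k + c * j)) =
        f $ Suc j * ((poly (pr k b) (q ^ j) * q_poch q (k + b * j)) *
          (poly (pr (n - k) c) (q ^ j) * q_poch q (n - k + c * j)))"
      by simp
    also have "\<dots> = poly (pr n a) (q ^ j) * q_poch q (n + a * j)"
      unfolding pr f ..
    also have "\<dots> = (poly (pr n a) (q ^ j) * f $ j) * (q_poch q (k + b * j) * q_poch q (n - k + c * j))"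
      unfolding f[symmetric] by (simp only: mult.assoc)
    finally show "poly (pr k b * pr (n - k) c) (q ^ j) * f $ Suc j = poly (pr n a) (q ^ j) * f $ j"
      using D by simp
  qed (use q in auto)
  thus ?thesis by (simp add: f_def)
qed

section \<open>Sections and binomial series\<close>

text \<open>Substitute in the equation itself: since c x^m is not constant, the leading coefficient
  stays nonzero.\<close>

lemma algebraic_fps_compose_monom:
  assumes f: "algebraic_fps f" and c: "c \<noteq> 0" and m: "m > 0"
  shows "algebraic_fps (f oo (fps_const c * fps_X ^ m))"
proof -
  define g where "g = fps_const c * fps_X ^ m"
  have g0: "g $ 0 = 0" using m by (simp add: g_def)
  obtain P where P: "P \<noteq> 0" "poly (map_poly fps_of_poly P) f = 0"
    using f by (auto simp: algebraic_fps_def)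
  define N where "N = degree P"
  have g: "fps_of_poly (monom c m) = g" by (simp add: g_def fps_of_poly_monom)
  have "0 = (\<Sum>i\<le>N. fps_of_poly (coeff P i) * f ^ i) oo g"
    using poly_fps_of_poly_altdef[of P N f] P(2) by (simp add: N_def)
  also have "\<dots> = (\<Sum>i\<le>N. fps_of_poly (pcompose (coeff P i) (monom c m)) * (f oo g) ^ i)"
    using m g0
    by (simp add: fps_compose_sum_distrib fps_compose_mult_distrib fps_compose_power
        fps_of_poly_pcompose g)
  finally have "(\<Sum>i\<le>N. fps_of_poly (pcompose (coeff P i) (monom c m)) * (f oo g) ^ i) = 0" ..
  moreover have "pcompose (coeff P N) (monom c m) \<noteq> 0"
    using P(1) m c by (simp add: pcompose_eq_0_iff degree_monom_eq N_def)
  ultimately show ?thesis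
    unfolding g_def by (rule algebraic_fpsI[where i = N]) auto
qed

text \<open>An algebraic equation for \<open>f(x\<^sup>b)\<close> splits according to the exponents of \<open>x\<close> modulo \<open>b\<close>.\<close>

lemma algebraic_fps_of_compose_X_power:
  assumes f: "algebraic_fps (f oo fps_X ^ b)" and b: "b > 0"
  shows "algebraic_fps f"
proof -
  obtain P where P: "P \<noteq> 0" "poly (map_poly fps_of_poly P) (f oo fps_X ^ b) = 0"
    using f by (auto simp: algebraic_fps_def)
  define N where "N = degree P"
  define t where "t = degree (coeff P N)"
  \<comment> \<open>This residue class contains the exponent \<open>t\<close> of a nonzero term of
    the leading coefficient, so the selected part of the equation is nontrivial. In
    \<open>d\<close>, x^b is renamed to x.\<close>
  define \<rho> where "\<rho> = t mod b"
  define d where "d = (\<lambda>i. \<Sum>j\<le>degree (coeff P i). monom (coeff (coeff P i) (\<rho> + b * j)) j)"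
  have d: "coeff (d i) j = coeff (coeff P i) (\<rho> + b * j)" for i j
  proof (cases "j \<le> degree (coeff P i)")
    case False
    have "j \<le> b * j" using b by simp
    hence "degree (coeff P i) < \<rho> + b * j" using False by linarith
    thus ?thesis using False by (simp add: d_def coeff_sum coeff_eq_0)
  qed (simp add: d_def coeff_sum)
  have pow: "(f oo fps_X ^ b) ^ i $ j = (if b dvd j then (f ^ i) $ (j div b) else 0)" for i j
  proof -
    have "(f oo fps_X ^ b) ^ i = f ^ i oo fps_X ^ b"
      using b by (simp add: fps_compose_power)
    thus ?thesis using b by (simp add: fps_nth_compose_X_power)
  qed
  have "(\<Sum>i\<le>N. fps_of_poly (d i) * f ^ i) = 0"
  proof (rule fps_ext)
    fix J
    have "0 = (\<Sum>i\<le>N. fps_of_poly (coeff P i) * (f oo fps_X ^ b) ^ i) $ (\<rho> + b * J)"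
      using poly_fps_of_poly_altdef[of P N "f oo fps_X ^ b"] P(2) by (simp add: N_def)
    also have "\<dots> = (\<Sum>i\<le>N. \<Sum>l\<le>\<rho> + b * J. coeff (coeff P i) l *
        (if b dvd \<rho> + b * J - l then (f ^ i) $ ((\<rho> + b * J - l) div b) else 0))"
      by (simp add: fps_sum_nth fps_mult_nth pow atLeast0AtMost)
    also have "\<dots> = (\<Sum>i\<le>N. \<Sum>l\<le>J. coeff (coeff P i) (\<rho> + b * l) * (f ^ i) $ (J - l))"
    proof (rule sum.cong[OF refl])
      fix i
      have inj: "inj_on (\<lambda>l. \<rho> + b * l) {..J}" using b by (auto simp: inj_on_def)
      have "(\<Sum>l\<le>\<rho> + b * J. coeff (coeff P i) l *
          (if b dvd \<rho> + b * J - l then (f ^ i) $ ((\<rho> + b * J - l) div b) else 0)) =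
          (\<Sum>l\<in>(\<lambda>l. \<rho> + b * l) ` {..J}. coeff (coeff P i) l *
          (if b dvd \<rho> + b * J - l then (f ^ i) $ ((\<rho> + b * J - l) div b) else 0))"
      proof (rule sum.mono_neutral_right)
        show "\<forall>l\<in>{..\<rho> + b * J} - (\<lambda>l. \<rho> + b * l) ` {..J}. coeff (coeff P i) l *
          (if b dvd \<rho> + b * J - l then (f ^ i) $ ((\<rho> + b * J - l) div b) else 0) = 0"
        proof
          fix l assume l: "l \<in> {..\<rho> + b * J} - (\<lambda>l. \<rho> + b * l) ` {..J}"
          have "\<not> b dvd \<rho> + b * J - l"
          proof
            assume "b dvd \<rho> + b * J - l"
            then obtain e where e: "\<rho> + b * J - l = b * e" by blast
            have rho: "\<rho> < b" using b by (simp add: \<rho>_def)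
            have "b * e < b * Suc J" using e rho by simp
            hence "e < Suc J" using b by (simp only: mult_less_cancel1)
            hence "e \<le> J" by simp
            hence "b * e \<le> b * J" by simp
            moreover have "l \<le> \<rho> + b * J" using l by simp
            ultimately have "l = \<rho> + b * (J - e)" using e unfolding diff_mult_distrib2 by linarith
            thus False using l by auto
          qed
          thus "coeff (coeff P i) l *
            (if b dvd \<rho> + b * J - l then (f ^ i) $ ((\<rho> + b * J - l) div b) else 0) = 0" by simp
        qed
      qed auto
      also have "\<dots> = (\<Sum>l\<le>J. coeff (coeff P i) (\<rho> + b * l) * (f ^ i) $ (J - l))"
        unfolding sum.reindex[OF inj] using b
        by (intro sum.cong) (auto simp flip: diff_mult_distrib2)
      finally show "(\<Sum>l\<le>\<rho> + b * J. coeff (coeff P i) l *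
          (if b dvd \<rho> + b * J - l then (f ^ i) $ ((\<rho> + b * J - l) div b) else 0)) =
          (\<Sum>l\<le>J. coeff (coeff P i) (\<rho> + b * l) * (f ^ i) $ (J - l))" .
    qed
    also have "\<dots> = (\<Sum>i\<le>N. fps_of_poly (d i) * f ^ i) $ J"
      by (simp add: fps_sum_nth fps_mult_nth d atLeast0AtMost)
    finally show "(\<Sum>i\<le>N. fps_of_poly (d i) * f ^ i) $ J = 0 $ J" by simp
  qed
  moreover have "coeff (d N) (t div b) \<noteq> 0"
    using P(1) by (simp add: d \<rho>_def t_def N_def)
  hence "d N \<noteq> 0" by auto
  ultimately show ?thesis by (rule algebraic_fpsI[where i = N]) auto
qed

text \<open>Multiplication by \<open>\<zeta>\<close> permutes the roots, so the sum equals itself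
  times \<open>\<zeta> ^ j\<close>, which differs from 1 unless \<open>b\<close> divides
  \<open>j\<close>.\<close>

lemma sum_roots_unity_power:
  assumes "b > 0"
  shows "(\<Sum>z | z ^ b = (1::complex). z ^ j) = (if b dvd j then of_nat b else 0)"
proof (cases "b dvd j")
  case True
  then obtain e where "j = b * e" by blast
  hence "(\<Sum>z | z ^ b = (1::complex). z ^ j) = (\<Sum>z | z ^ b = (1::complex). 1)"
    by (intro sum.cong) (auto simp: power_mult)
  thus ?thesis using True assms by (simp add: card_roots_unity_eq)
next
  case False
  define r where "r = j mod b"
  have r: "0 < r" "r < b" using False assms by (auto simp: r_def dvd_eq_mod_eq_0)
  define S where "S = (\<Sum>z | z ^ b = (1::complex). z ^ j)"
  note bij = bij_betw_roots_unity[OF assms]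
  define \<zeta> where "\<zeta> = cis (2 * pi / real b)"
  have "\<zeta> ^ b = 1" using assms by (simp add: \<zeta>_def DeMoivre)
  have "\<zeta> ^ j = \<zeta> ^ (b * (j div b) + r)" by (simp add: r_def)
  also have "\<dots> = \<zeta> ^ r" unfolding power_add power_mult \<open>\<zeta> ^ b = 1\<close> by simp
  also have "\<dots> = cis (2 * pi * real r / real b)" by (simp add: \<zeta>_def DeMoivre mult_ac)
  also have "\<dots> \<noteq> cis (2 * pi * real 0 / real b)"
    using inj_onD[OF bij_betw_imp_inj_on[OF bij], of r 0] r assms by auto
  finally have "\<zeta> ^ j \<noteq> 1" by simp
  have "S = (\<Sum>z | z ^ b = 1. (\<zeta> * z) ^ j)"
    unfolding S_def
    by (rule sum.reindex_bij_witness[of _ "\<lambda>z. \<zeta> * z" "\<lambda>z. z / \<zeta>"])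
      (use \<open>\<zeta> ^ b = 1\<close> in \<open>auto simp: \<zeta>_def power_mult_distrib power_divide\<close>)
  also have "\<dots> = \<zeta> ^ j * S" by (simp add: S_def power_mult_distrib sum_distrib_left)
  finally have "S = 0" using \<open>\<zeta> ^ j \<noteq> 1\<close> by simp
  thus ?thesis using False by (simp add: S_def)
qed

lemma algebraic_fps_shift:
  assumes "algebraic_fps f"
  shows "algebraic_fps (fps_shift k f)"
proof (rule algebraic_fps_cancel[of "fps_X ^ k"])
  show "algebraic_fps (fps_X ^ k :: complex fps)"
    using algebraic_fps_of_poly[of "monom 1 k"] by (simp add: fps_of_poly_monom')
  have "fps_X ^ k * fps_shift k f = f + fps_of_poly (- truncate_fps k f)"
    using fps_shift_cutoff[of k f] by (simp add: fps_of_poly_uminus algebra_simps)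
  thus "algebraic_fps (fps_X ^ k * fps_shift k f)"
    using assms by (simp only: algebraic_fps_add algebraic_fps_of_poly)
qed simp

text \<open>After a shift by \<open>k\<close>, averaging over the substitutions x -> z x with z^b =
  1 keeps exactly the exponents divisible by \<open>b\<close>. This is the section composed with
  x^b.\<close>

lemma algebraic_fps_section:
  assumes F: "algebraic_fps F" and b: "b > 0"
  shows "algebraic_fps (Abs_fps (\<lambda>j. F $ (k + b * j)))"
proof (rule algebraic_fps_of_compose_X_power[OF _ b])
  define G where "G = fps_shift k F"
  define Z where "Z = {z::complex. z ^ b = 1}"
  have "Abs_fps (\<lambda>j. F $ (k + b * j)) oo fps_X ^ b =
      fps_of_poly [:1 / of_nat b:] * (\<Sum>z\<in>Z. G oo (fps_const z * fps_X ^ 1))"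
  proof (rule fps_ext)
    fix j
    have "(fps_of_poly [:1 / of_nat b:] * (\<Sum>z\<in>Z. G oo (fps_const z * fps_X ^ 1))) $ j =
        (\<Sum>z\<in>Z. z ^ j) * G $ j / of_nat b"
      by (simp add: fps_of_poly_const fps_sum_nth fps_compose_linear sum_distrib_right)
    also have "\<dots> = (Abs_fps (\<lambda>j. F $ (k + b * j)) oo fps_X ^ b) $ j"
      using b sum_roots_unity_power[OF b, of j]
      by (simp add: fps_nth_compose_X_power Z_def G_def add.commute)
    finally show "(Abs_fps (\<lambda>j. F $ (k + b * j)) oo fps_X ^ b) $ j =
        (fps_of_poly [:1 / of_nat b:] * (\<Sum>z\<in>Z. G oo (fps_const z * fps_X ^ 1))) $ j" ..
  qed
  moreover have "z \<noteq> 0" if "z \<in> Z" for z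
    using that b by (auto simp: Z_def zero_power)
  ultimately show "algebraic_fps (Abs_fps (\<lambda>j. F $ (k + b * j)) oo fps_X ^ b)"
    using algebraic_fps_shift[OF F, of k] unfolding G_def
    by (simp only:) (intro algebraic_fps_mult algebraic_fps_of_poly algebraic_fps_sum
        algebraic_fps_compose_monom zero_less_one)
qed

section \<open>Lagrange inversion and binomial series\<close>

lemma fps_compose_mult_nth:
  fixes F :: "'a::comm_ring_1 fps"
  assumes "g $ 0 = 0"
  shows "((F oo g) * E) $ m = (\<Sum>i\<le>m. F $ i * (g ^ i * E) $ m)"
proof -
  have "((F oo g) * E) $ m = (\<Sum>j\<le>m. (\<Sum>i\<le>m. F $ i * (g ^ i) $ j) * E $ (m - j))"
    unfolding fps_mult_nth fps_compose_nth atLeast0AtMost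
    using startsby_zero_power_prefix[OF assms]
    by (intro sum.cong refl arg_cong2[of _ _ _ _ "(*)"] sum.mono_neutral_left) auto
  also have "\<dots> = (\<Sum>i\<le>m. F $ i * (g ^ i * E) $ m)"
    unfolding fps_mult_nth atLeast0AtMost sum_distrib_left sum_distrib_right
    by (subst sum.swap) (simp only: mult.assoc)
  finally show ?thesis .
qed

text \<open>Lagrange inversion for \<open>x = t (1 + t) powr (-s)\<close>; the factor \<open>1 + (1 - s) t\<close> comes from
  \<open>dx/dt = (1 + t) powr (-s - 1) (1 + (1 - s) t)\<close>.\<close>

lemma gbinomial_series_compose:
  fixes r s :: "'a::field_char_0"
  defines "\<psi> \<equiv> fps_X * fps_binomial (- s)"
  shows "(Abs_fps (\<lambda>m. (r + s * of_nat m) gchoose m) oo \<psi>) * (1 + fps_const (1 - s) * fps_X) =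
    fps_binomial (r + 1)"
proof -
  define K where "K = 1 + fps_const (1 - s) * fps_X"
  have K: "K $ 0 \<noteq> 0" by (simp add: K_def)
  define H where "H = fps_binomial (r + 1) * inverse K"
  have HK: "H * K = fps_binomial (r + 1)"
    using K by (simp add: H_def mult.assoc inverse_mult_eq_1)
  \<comment> \<open>\<open>G\<close> is the series in x that becomes \<open>H\<close> under x =
    \<open>\<psi>\<close>; it remains to compute its coefficients.\<close>
  define G where "G = H oo fps_inv \<psi>"
  have \<psi>: "\<psi> $ 0 = 0" "\<psi> $ 1 \<noteq> 0" by (auto simp: \<psi>_def)
  have inv0: "fps_inv \<psi> $ 0 = 0" by (simp add: fps_inv_def)
  have G: "G oo \<psi> = H"
    using fps_compose_assoc[OF \<psi>(1) inv0, of H] fps_inv[OF \<psi>] by (simp add: G_def)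
  have \<psi>_pow: "\<psi> ^ i = fps_X ^ i * fps_binomial (- (s * of_nat i))" for i
    by (simp add: \<psi>_def power_mult_distrib fps_binomial_power mult.commute)
  \<comment> \<open>This takes the place of the residue in Lagrange inversion: used with d = m - i,
    it singles out the term i = m.\<close>
  have key: "(K * fps_binomial (s * of_nat d - 1)) $ d = (if d = 0 then 1 else 0)" for d
  proof (cases d)
    case 0
    thus ?thesis by (simp add: K_def)
  next
    case (Suc e)
    define x where "x = s * of_nat d - 1"
    have "of_nat d * (x gchoose d) = (x - of_nat e) * (x gchoose e)"
      using gbinomial_mult_1[of x e] by (simp add: Suc algebra_simps)
    also have "x - of_nat e = of_nat d * (s - 1)" by (simp add: x_def Suc algebra_simps)
    finally have "x gchoose d = (s - 1) * (x gchoose e)"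
      using Suc by (simp del: of_nat_Suc)
    hence "(x gchoose d) + (1 - s) * (x gchoose e) = 0" by (simp add: algebra_simps)
    moreover have "(K * fps_binomial x) $ d = (x gchoose d) + (1 - s) * (x gchoose e)"
      by (simp add: K_def Suc algebra_simps)
    ultimately show ?thesis by (simp add: x_def Suc)
  qed
  have "G $ m = (r + s * of_nat m) gchoose m" for m
  proof -
    have "(r + s * of_nat m) gchoose m = (fps_binomial (r + 1) * fps_binomial (s * of_nat m - 1)) $ m"
      by (simp flip: fps_binomial_add_mult)
    also have "\<dots> = ((G oo \<psi>) * (K * fps_binomial (s * of_nat m - 1))) $ m"
      by (simp add: G HK[symmetric] mult.assoc)
    also have "\<dots> = (\<Sum>i\<le>m. G $ i * (\<psi> ^ i * (K * fps_binomial (s * of_nat m - 1))) $ m)"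
      by (rule fps_compose_mult_nth[OF \<psi>(1)])
    also have "\<dots> = (\<Sum>i\<le>m. if i = m then G $ i else 0)"
    proof (rule sum.cong[OF refl])
      fix i assume i: "i \<in> {..m}"
      have "\<psi> ^ i * (K * fps_binomial (s * of_nat m - 1)) =
          fps_X ^ i * (K * (fps_binomial (- (s * of_nat i)) * fps_binomial (s * of_nat m - 1)))"
        by (simp add: \<psi>_pow mult_ac)
      also have "fps_binomial (- (s * of_nat i)) * fps_binomial (s * of_nat m - 1) =
          fps_binomial (s * of_nat (m - i) - 1)"
        using i by (simp add: algebra_simps of_nat_diff flip: fps_binomial_add_mult)
      finally have eq: "\<psi> ^ i * (K * fps_binomial (s * of_nat m - 1)) =
          fps_X ^ i * (K * fps_binomial (s * of_nat (m - i) - 1))" .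
      show "G $ i * (\<psi> ^ i * (K * fps_binomial (s * of_nat m - 1))) $ m =
          (if i = m then G $ i else 0)"
        unfolding eq using i key[of "m - i"] by (auto simp: fps_X_power_mult_nth)
    qed
    also have "\<dots> = G $ m" by simp
    finally show ?thesis ..
  qed
  hence "Abs_fps (\<lambda>m. (r + s * of_nat m) gchoose m) = G" by (simp add: fps_eq_iff)
  thus ?thesis using G HK by (simp add: K_def)
qed

text \<open>With \<open>T\<close> the inverse of t (1 + t)^(-s) and \<open>w\<close> = (1 +
  T)^(1/b), one has T = x w^a and so w^b = 1 + x w^a. The series is a quotient of elements of an
  algebra containing \<open>w\<close>.\<close>

lemma gbinomial_series_algebraic:
  fixes n k a b :: nat
  assumes "a > 0" "b > 0"
  defines "s \<equiv> of_nat a / of_nat b :: complex"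
  shows "algebraic_fps (Abs_fps (\<lambda>m. (of_nat n - s * of_nat k + s * of_nat m) gchoose m))"
proof -
  define r where "r = of_nat n - s * of_nat k"
  define F where "F = Abs_fps (\<lambda>m. (r + s * of_nat m) gchoose m)"
  define \<psi> where "\<psi> = fps_X * fps_binomial (- s)"
  define T where "T = fps_inv \<psi>"
  have \<psi>: "\<psi> $ 0 = 0" "\<psi> $ 1 \<noteq> 0" by (auto simp: \<psi>_def)
  have T0: "T $ 0 = 0" by (simp add: T_def fps_inv_def)
  note comp = fps_compose_mult_distrib[OF T0] fps_compose_add_distrib fps_compose_power[OF T0, symmetric]
  have \<psi>T: "\<psi> oo T = fps_X" unfolding T_def by (rule fps_inv_right[OF \<psi>])
  have FT: "F * (1 + fps_const (1 - s) * T) = fps_binomial (r + 1) oo T"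
  proof -
    have "((F oo \<psi>) oo T) * (1 + fps_const (1 - s) * T) =
        ((F oo \<psi>) * (1 + fps_const (1 - s) * fps_X)) oo T"
      using T0 by (simp add: comp)
    also have "(F oo \<psi>) * (1 + fps_const (1 - s) * fps_X) = fps_binomial (r + 1)"
      unfolding F_def \<psi>_def by (rule gbinomial_series_compose)
    also have "(F oo \<psi>) oo T = F"
      using fps_compose_assoc[OF T0 \<psi>(1), of F] by (simp add: \<psi>T)
    finally show ?thesis .
  qed
  define w where "w = fps_binomial (1 / of_nat b) oo T"
  have w: "w ^ i = fps_binomial (of_nat i / of_nat b) oo T" for i
    using fps_compose_power[OF T0, of "fps_binomial (1 / of_nat b)" i]
    by (simp add: w_def fps_binomial_power)
  have wb: "w ^ (b * i) = (1 + T) ^ i" for i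
  proof -
    have "w ^ (b * i) = fps_binomial (of_nat i) oo T" using assms(2) by (simp add: w)
    thus ?thesis using T0 by (simp add: fps_binomial_of_nat comp)
  qed
  have wa: "fps_X * w ^ a = T"
  proof -
    have "fps_X * w ^ a = (\<psi> oo T) * (fps_binomial s oo T)" by (simp add: \<psi>T w s_def)
    also have "\<dots> = (fps_X * (fps_binomial (- s) * fps_binomial s)) oo T"
      by (simp add: \<psi>_def comp mult.assoc)
    also have "\<dots> = T" using T0 by (simp flip: fps_binomial_add_mult)
    finally show ?thesis .
  qed
  have "algebraic_fps w"
  proof (rule algebraic_fpsI)
    define c where "c = (\<lambda>i. (if i = b then 1 else 0) - (if i = 0 then 1 else 0) -
      (if i = a then [:0, 1::complex:] else 0))"
    have "(\<Sum>i\<le>a + b. fps_of_poly (c i) * w ^ i) =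
        (\<Sum>i\<le>a + b. (if i = b then w ^ i else 0) - (if i = 0 then w ^ i else 0) -
          (if i = a then fps_X * w ^ i else 0))"
      using assms(1,2) by (intro sum.cong) (auto simp: c_def fps_of_poly_diff algebra_simps)
    also have "\<dots> = w ^ b - 1 - fps_X * w ^ a"
      by (simp add: sum_subtractf)
    also have "\<dots> = 0" using wb[of 1] wa by simp
    finally show "(\<Sum>i\<le>a + b. fps_of_poly (c i) * w ^ i) = 0" .
    \<comment> \<open>The x-coefficient is inspected because it is -1 even if a = b.\<close>
    have "coeff (c a) 1 = -1" by (simp add: c_def)
    thus "c a \<noteq> 0" by auto
  qed simp
  then obtain R where R: "fin_alg R" "w \<in> R" by (rule algebraic_imp_fin_alg)
  have "T = w ^ b - 1" using wb[of 1] by simp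
  hence TR: "T \<in> R" using R by (auto intro: fin_alg_diff fin_alg_power fin_alg_one)
  have const: "fps_const x = fps_of_poly [:x:]" for x :: complex by (simp add: fps_of_poly_const)
  \<comment> \<open>The factor w^(a k) = (1 + T)^(s k) makes the exponent r + 1 + s k equal to the
    integer n + 1.\<close>
  define V where "V = (1 + fps_const (1 - s) * T) * w ^ (a * k)"
  have "V * F = (fps_binomial (r + 1) oo T) * w ^ (a * k)"
    unfolding V_def FT[symmetric] by (simp only: mult_ac)
  also have "\<dots> = fps_binomial (of_nat (Suc n)) oo T"
    by (simp add: w r_def s_def algebra_simps flip: comp fps_binomial_add_mult)
  also have "\<dots> = (1 + T) ^ Suc n" using T0 unfolding fps_binomial_of_nat by (simp add: comp)
  also have "\<dots> \<in> R" by (intro fin_alg_power fin_alg_add fin_alg_one R TR)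
  finally have "V * F \<in> R" .
  moreover have "V \<in> R"
    unfolding V_def const
    by (intro fin_alg_mult fin_alg_add fin_alg_one fin_alg_power fin_alg_scale R TR)
  moreover have "V \<noteq> 0"
  proof -
    have "w $ 0 = 1" by (simp add: w_def)
    hence "V $ 0 = 1" using T0 by (simp add: V_def fps_power_zeroth)
    thus ?thesis by auto
  qed
  ultimately have "F \<in> R" using fin_alg_cancel R by blast
  thus ?thesis using R fin_alg_imp_algebraic by (auto simp: F_def r_def)
qed

text \<open>These are the coefficients of the preceding series at the indices m = k + b j, where n -
  s k + s m = n + a j.\<close>

lemma binomial_series_algebraic:
  fixes n k a b :: nat
  assumes "a > 0" "b > 0"
  shows "algebraic_fps (Abs_fps (\<lambda>j. of_nat ((n + a * j) choose (k + b * j))))"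
proof -
  have "of_nat n - of_nat a / of_nat b * of_nat k + of_nat a / of_nat b * of_nat (k + b * j) =
      (of_nat (n + a * j) :: complex)" for j
    using assms by (simp add: field_simps)
  thus ?thesis
    using algebraic_fps_section[OF gbinomial_series_algebraic[OF assms, of n k] assms(2), of k]
    by (simp only: fps_nth_Abs_fps binomial_gbinomial)
qed

section \<open>The case where q is a root of unity\<close>

lemma fps_eq_sum_sections:
  fixes f :: "'a::idom fps"
  assumes "m > 0"
  shows "f = (\<Sum>r<m. fps_X ^ r * (Abs_fps (\<lambda>i. f $ (r + m * i)) oo fps_X ^ m))"
proof (rule fps_ext)
  fix j
  have "(\<Sum>r<m. fps_X ^ r * (Abs_fps (\<lambda>i. f $ (r + m * i)) oo fps_X ^ m)) $ j =
      (\<Sum>r<m. if r = j mod m then f $ j else 0)"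
    unfolding fps_sum_nth
  proof (rule sum.cong[OF refl])
    fix r assume r: "r \<in> {..<m}"
    have "(r \<le> j \<and> m dvd j - r) = (r = j mod m)"
      using r by (auto simp: mod_eq_dvd_iff_nat[symmetric])
    thus "(fps_X ^ r * (Abs_fps (\<lambda>i. f $ (r + m * i)) oo fps_X ^ m)) $ j =
        (if r = j mod m then f $ j else 0)"
      using assms by (auto simp: fps_X_power_mult_nth fps_nth_compose_X_power)
  qed
  thus "f $ j = (\<Sum>r<m. fps_X ^ r * (Abs_fps (\<lambda>i. f $ (r + m * i)) oo fps_X ^ m)) $ j"
    using assms by simp
qed

lemma gauss_series_algebraic:
  fixes n k a b :: nat and q :: complex
  assumes "a > 0" "b > 0" and root: "\<exists>m>0. q ^ m = 1"
  shows "algebraic_fps (Abs_fps (\<lambda>j. gauss q (n + a * j) (k + b * j)))"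
proof -
  define m where "m = (LEAST m. m > 0 \<and> q ^ m = 1)"
  have m: "m > 0" "q ^ m = 1" using LeastI_ex[OF root] by (auto simp: m_def)
  have prim: "q ^ i \<noteq> 1" if "0 < i" "i < m" for i
    using not_less_Least[of i "\<lambda>m. m > 0 \<and> q ^ m = 1"] that by (auto simp: m_def)
  define f where "f = Abs_fps (\<lambda>j. gauss q (n + a * j) (k + b * j))"
  have section_alg: "algebraic_fps (Abs_fps (\<lambda>i. f $ (r + m * i)))" for r
  proof -
    \<comment> \<open>Adding m a i to \<open>N\<close> and m b i to \<open>K\<close> fixes the
      residues modulo \<open>m\<close> and moves the quotients by a i and b i, so the q-Lucas
      theorem leaves a constant factor.\<close>
    define N K where "N = n + a * r" and "K = k + b * r"
    have "f $ (r + m * i) = gauss q (N mod m) (K mod m) *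
        of_nat ((N div m + a * i) choose (K div m + b * i))" for i
    proof -
      have "f $ (r + m * i) = gauss q (m * (a * i) + N) (m * (b * i) + K)"
        by (simp add: f_def N_def K_def algebra_simps)
      thus ?thesis
        using q_Lucas[OF m prim, of "m * (a * i) + N" "m * (b * i) + K"] m(1)
        by (simp add: add.commute)
    qed
    hence "Abs_fps (\<lambda>i. f $ (r + m * i)) = fps_of_poly [:gauss q (N mod m) (K mod m):] *
        Abs_fps (\<lambda>i. of_nat ((N div m + a * i) choose (K div m + b * i)))"
      by (simp add: fps_eq_iff fps_of_poly_const)
    thus ?thesis
      by (simp only: algebraic_fps_mult algebraic_fps_of_poly binomial_series_algebraic[OF assms(1,2)])
  qed
  have "algebraic_fps (fps_X ^ r * (Abs_fps (\<lambda>i. f $ (r + m * i)) oo fps_X ^ m))" for r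
    using algebraic_fps_of_poly[of "monom 1 r"] m(1)
      algebraic_fps_compose_monom[OF section_alg[of r], of 1 m]
    by (intro algebraic_fps_mult) (simp_all add: fps_of_poly_monom')
  hence "algebraic_fps f"
    by (subst fps_eq_sum_sections[OF m(1), of f]) (intro algebraic_fps_sum)
  thus ?thesis by (simp add: f_def)
qed

theorem theorem4:
  fixes n k a b :: nat and q :: complex
  assumes "n \<ge> k" and "a > b" and "b > 0" and "coprime a b"
    and "n - k < a - b \<or> k < b"
    and "q \<noteq> 0"
  shows "algebraic_fps (Abs_fps (\<lambda>j. q_binomial_at q (n + a * j) (k + b * j)))
           \<longleftrightarrow> (\<exists>m::nat. m > 0 \<and> q ^ m = 1)"
proof -
  have "k + b * j \<le> n + a * j" for j
    using assms(1,2) by (intro add_mono mult_right_mono) auto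
  thus ?thesis
    using gauss_series_algebraic[of a b q n k] gauss_series_not_algebraic[of k n b a q] assms
    by (auto simp: q_binomial_at_eq_gauss)
qed

end
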